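(* Let $\mathcal{S}$ and $\mathcal{T}$ be finite dimensional operator systems and let $m\in\mathbb{N}$. An element $U \in M_m(\mathcal{S} \otimes_{\max} \mathcal{T})$ is positive if and only if $\hat{U}\colon \mathcal{S}^d \to M_m(\mathcal{T})$ factors through $M_n$ approximately, i.e. there exist nets of completely positive maps $\varphi_\lambda\colon \mathcal{S}^d\to M_{n_\lambda}$ and $\psi_\lambda\colon M_{n_\lambda}\to M_m(\mathcal{T})$ such that $\psi_\lambda\circ\varphi_\lambda$ converges to $\hat{U}$ in the point-norm topology.
   Context: An operator system is a unital self-adjoint subspace of $\mathcal{B}(\mathcal{H})$ for a Hilbert space $\mathcal{H}$, with cones $M_n(\mathcal{S})^+$ and unit $1_{\mathcal{S}}$. $\mathcal{S}^d$ is the linear dual of $\mathcal{S}$. For $U=[u_{kl}]\in M_m(\mathcal{S}\otimes\mathcal{T})$ (identified with an element of $\mathcal{S}\otimes M_m(\mathcal{T})$), $\hat{U}\colon\mathcal{S}^d\to M_m(\mathcal{T})$ is $\hat{U}(f)=[\hat{u}_{kl}(f)]$, where for $u=\sum_i x_i\otimes y_i\in\mathcal{S}\otimes\mathcal{T}$ one sets $\hat{u}(f)=\sum_i f(x_i)y_i$. For $\mathcal{S}$ finite dimensional, $\mathcal{S}^d$ is an operator system with matricial cones: $[f_{ij}]\in M_n(\mathcal{S}^d)^+$ iff the map $\mathcal{S}\to M_n$, $s\mapsto[f_{ij}(s)]$, is completely positive (the order unit being a faithful state on $\mathcal{S}$). $M_{n,k}$ denotes complex $n\times k$ matrices, and $P\otimes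 Q=[p_{ij}\otimes Q]$ is the Kronecker tensor product. Define $$\mathcal{D}_n^{\max}(\mathcal{S},\mathcal{T})=\{A(P\otimes Q)A^*: P\in M_k(\mathcal{S})^+,\ Q\in M_r(\mathcal{T})^+,\ A\in M_{n,kr},\ k,r\in\mathbb{N}\}.$$ The maximal tensor product $\mathcal{S}\otimes_{\max}\mathcal{T}$ is $\mathcal{S}\otimes\mathcal{T}$ with unit $1_{\mathcal{S}}\otimes 1_{\mathcal{T}}$ and cones $M_n(\mathcal{S}\otimes_{\max}\mathcal{T})^+=\{U\in M_n(\mathcal{S}\otimes\mathcal{T}): \varepsilon (I_n\otimes 1_{\mathcal{S}}\otimes 1_{\mathcal{T}})+U\in\mathcal{D}_n^{\max}(\mathcal{S},\mathcal{T})\ \forall\varepsilon>0\}$. *)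

theory Defs
  imports "HOL-Analysis.Analysis" "HOL-Library.Function_Algebras" "HOL-Library.Poly_Mapping"
begin

section \<open>Complex vector spaces\<close>

class complex_vector = ab_group_add +
  fixes scaleC :: "complex \<Rightarrow> 'a \<Rightarrow> 'a" (infixr "*\<^sub>C" 75)
  assumes scaleC_add_right: "c *\<^sub>C (x + y) = c *\<^sub>C x + c *\<^sub>C y"
    and scaleC_add_left: "(c + d) *\<^sub>C x = c *\<^sub>C x + d *\<^sub>C x"
    and scaleC_scaleC: "c *\<^sub>C d *\<^sub>C x = (c * d) *\<^sub>C x"
    and scaleC_one: "1 *\<^sub>C x = x"

global_interpretation complex_vector:
  vector_space "scaleC :: complex \<Rightarrow> 'a \<Rightarrow> 'a::complex_vector"
  by unfold_locales (simp_all add: scaleC_add_right scaleC_add_left scaleC_scaleC scaleC_one)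

instantiation complex :: complex_vector
begin
definition scaleC_complex :: "complex \<Rightarrow> complex \<Rightarrow> complex"
  where "scaleC_complex c x = c * x"
instance by standard (simp_all add: scaleC_complex_def algebra_simps)
end

instantiation "fun" :: (type, complex_vector) complex_vector
begin
definition scaleC_fun :: "complex \<Rightarrow> ('a \<Rightarrow> 'b) \<Rightarrow> 'a \<Rightarrow> 'b"
  where "scaleC_fun c f = (\<lambda>x. c *\<^sub>C f x)"
instance
  by standard (simp_all add: scaleC_fun_def fun_eq_iff scaleC_add_right scaleC_add_left
      scaleC_scaleC scaleC_one)
end

instantiation poly_mapping :: (type, complex_vector) complex_vector
begin
lift_definition scaleC_poly_mapping :: "complex \<Rightarrow> ('a \<Rightarrow>\<^sub>0 'b) \<Rightarrow> 'a \<Rightarrow>\<^sub>0 'b"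
  is "\<lambda>c f x. c *\<^sub>C f x"
  by (erule finite_subset[rotated]) auto
instance
  by standard (transfer; simp add: fun_eq_iff scaleC_add_right scaleC_add_left
      scaleC_scaleC scaleC_one)+
end

definition fin_dim :: "'v::complex_vector set \<Rightarrow> bool"
  where "fin_dim V \<longleftrightarrow> (\<exists>B. finite B \<and> V = complex_vector.span B)"

definition clinear_on :: "'v::complex_vector set \<Rightarrow> ('v \<Rightarrow> 'w::complex_vector) \<Rightarrow> bool"
  where "clinear_on V f \<longleftrightarrow>
    (\<forall>x\<in>V. \<forall>y\<in>V. f (x + y) = f x + f y) \<and> (\<forall>c. \<forall>x\<in>V. f (c *\<^sub>C x) = c *\<^sub>C f x)"


section \<open>Hilbert spaces and bounded operators\<close>

text \<open>The inner product is linear in its first argument.\<close>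

class complex_hilbert = complex_vector + banach +
  fixes cinner :: "'a \<Rightarrow> 'a \<Rightarrow> complex"
  assumes scaleR_scaleC: "r *\<^sub>R x = complex_of_real r *\<^sub>C x"
    and cinner_commute: "cinner x y = cnj (cinner y x)"
    and cinner_add_left: "cinner (x + y) z = cinner x z + cinner y z"
    and cinner_scaleC_left: "cinner (c *\<^sub>C x) y = c * cinner x y"
    and cinner_self: "cinner x x = complex_of_real ((norm x)\<^sup>2)"

instantiation complex :: complex_hilbert
begin
definition cinner_complex :: "complex \<Rightarrow> complex \<Rightarrow> complex"
  where "cinner_complex x y = x * cnj y"
instance
proof
  fix r :: real and c x y z :: complex
  show "r *\<^sub>R x = complex_of_real r *\<^sub>C x"
    by (simp add: scaleC_complex_def scaleR_conv_of_real)
  show "cinner x y = cnj (cinner y x)" by (simp add: cinner_complex_def)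
  show "cinner (x + y) z = cinner x z + cinner y z"
    by (simp add: cinner_complex_def algebra_simps)
  show "cinner (c *\<^sub>C x) y = c * cinner x y"
    by (simp add: cinner_complex_def scaleC_complex_def)
  show "cinner x x = complex_of_real ((norm x)\<^sup>2)"
    by (simp only: cinner_complex_def complex_norm_square)
qed
end

typedef (overloaded) ('h::complex_hilbert) bop =
  "{A :: 'h \<Rightarrow> 'h. bounded_linear A \<and> (\<forall>c x. A (c *\<^sub>C x) = c *\<^sub>C A x)}"
  morphisms bop_apply Bop
  by (rule exI[of _ "\<lambda>x. x"]) simp

setup_lifting type_definition_bop

lemma bounded_linear_scaleC: "bounded_linear (\<lambda>x::'h::complex_hilbert. c *\<^sub>C x)"
proof (rule bounded_linear_intro[where K = "cmod c"])
  fix x y :: 'h and r :: real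
  show "c *\<^sub>C (x + y) = c *\<^sub>C x + c *\<^sub>C y" by (rule scaleC_add_right)
  show "c *\<^sub>C r *\<^sub>R x = r *\<^sub>R c *\<^sub>C x" by (simp add: scaleR_scaleC scaleC_scaleC mult.commute)
  have "cinner (c *\<^sub>C x) (c *\<^sub>C x) = c * cinner x (c *\<^sub>C x)" by (rule cinner_scaleC_left)
  also have "cinner x (c *\<^sub>C x) = cnj c * cinner x x"
    by (subst cinner_commute, subst cinner_scaleC_left, subst (2) cinner_commute) simp
  also have "c * (cnj c * cinner x x) = complex_of_real ((cmod c)\<^sup>2) * complex_of_real ((norm x)\<^sup>2)"
    unfolding cinner_self mult.assoc[symmetric] by (simp only: complex_norm_square)
  finally have "complex_of_real ((norm (c *\<^sub>C x))\<^sup>2) = complex_of_real ((cmod c * norm x)\<^sup>2)"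
    unfolding cinner_self of_real_mult[symmetric] by (simp only: power_mult_distrib)
  then have "(norm (c *\<^sub>C x))\<^sup>2 = (cmod c * norm x)\<^sup>2"
    by (simp only: of_real_eq_iff)
  then have "norm (c *\<^sub>C x) = cmod c * norm x"
    by (subst (asm) power2_eq_iff_nonneg) simp_all
  then show "norm (c *\<^sub>C x) \<le> norm x * cmod c" by simp
qed

instantiation bop :: (complex_hilbert) "{complex_vector, one}"
begin
lift_definition zero_bop :: "'a bop" is "\<lambda>x. 0" by simp
lift_definition one_bop :: "'a bop" is "\<lambda>x. x" by simp
lift_definition plus_bop :: "'a bop \<Rightarrow> 'a bop \<Rightarrow> 'a bop" is "\<lambda>A B x. A x + B x"
  by (simp add: bounded_linear_add scaleC_add_right)
lift_definition uminus_bop :: "'a bop \<Rightarrow> 'a bop" is "\<lambda>A x. - A x"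
  by (simp add: bounded_linear_minus)
lift_definition minus_bop :: "'a bop \<Rightarrow> 'a bop \<Rightarrow> 'a bop" is "\<lambda>A B x. A x - B x"
  by (simp add: bounded_linear_sub complex_vector.scale_right_diff_distrib)
lift_definition scaleC_bop :: "complex \<Rightarrow> 'a bop \<Rightarrow> 'a bop" is "\<lambda>c A x. c *\<^sub>C A x"
  by (simp add: bounded_linear_compose[OF bounded_linear_scaleC] scaleC_scaleC mult.commute)
instance
  by standard (transfer; simp add: fun_eq_iff algebra_simps scaleC_add_right scaleC_add_left
      scaleC_scaleC scaleC_one)+
end

definition is_adjoint :: "'h::complex_hilbert bop \<Rightarrow> 'h bop \<Rightarrow> bool"
  where "is_adjoint B A \<longleftrightarrow> (\<forall>x y. cinner (bop_apply A x) y = cinner x (bop_apply B y))"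

definition operator_system :: "'h::complex_hilbert bop set \<Rightarrow> bool"
  where "operator_system S \<longleftrightarrow>
    complex_vector.subspace S \<and> 1 \<in> S \<and> (\<forall>A\<in>S. \<exists>B\<in>S. is_adjoint B A)"


section \<open>Matrices over a vector space and matricial cones\<close>

text \<open>Matrices are functions of two indices (counted from 0) which vanish outside their format, so
  that the matrices of a given format over a subspace form a subspace of a function space.\<close>

type_synonym 'v matrix = "nat \<Rightarrow> nat \<Rightarrow> 'v"

definition mats :: "nat \<Rightarrow> nat \<Rightarrow> 'v::zero set \<Rightarrow> 'v matrix set"
  where "mats n k V = {X. \<forall>i j. if i < n \<and> j < k then X i j \<in> V else X i j = 0}"

text \<open>A vector space together with cones in its square matrices of every size.\<close>

record 'v mat_cones =
  vecs :: "'v set"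
  cone :: "nat \<Rightarrow> 'v matrix set"

definition completely_positive ::
  "'v::complex_vector mat_cones \<Rightarrow> 'w::complex_vector mat_cones \<Rightarrow> ('v \<Rightarrow> 'w) \<Rightarrow> bool"
  where "completely_positive V W f \<longleftrightarrow>
    clinear_on (vecs V) f \<and> f ` vecs V \<subseteq> vecs W \<and>
    (\<forall>k. \<forall>X\<in>cone V k. (\<lambda>i j. f (X i j)) \<in> cone W k)"

text \<open>An \<open>n \<times> n\<close> matrix over \<open>S \<subseteq> B(H)\<close> is positive if it is positive as an operator on \<open>H\<^sup>n\<close>.\<close>

definition op_sys :: "'h::complex_hilbert bop set \<Rightarrow> 'h bop mat_cones"
  where "op_sys S = \<lparr> vecs = S, cone = (\<lambda>n. {X \<in> mats n n S.
    \<forall>h. (\<Sum>i<n. \<Sum>j<n. cinner (bop_apply (X i j) (h j)) (h i)) \<in> \<real>\<^sub>\<ge>\<^sub>0}) \<rparr>"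

definition scalars :: "complex mat_cones"
  where "scalars = \<lparr> vecs = UNIV, cone = (\<lambda>n. {X \<in> mats n n UNIV.
    \<forall>v. (\<Sum>i<n. \<Sum>j<n. cnj (v i) * X i j * v j) \<in> \<real>\<^sub>\<ge>\<^sub>0}) \<rparr>"

text \<open>\<open>M\<^sub>n(V)\<close>, with \<open>M\<^sub>k(M\<^sub>n(V))\<close> identified with \<open>M\<^sub>k\<^sub>n(V)\<close> by forgetting the block structure.\<close>

definition unblock :: "nat \<Rightarrow> nat \<Rightarrow> 'v::zero matrix matrix \<Rightarrow> 'v matrix"
  where "unblock k n X = (\<lambda>p q. if p < k * n \<and> q < k * n
    then X (p div n) (q div n) (p mod n) (q mod n) else 0)"

definition mat_over :: "nat \<Rightarrow> 'v::zero mat_cones \<Rightarrow> 'v matrix mat_cones"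
  where "mat_over n V = \<lparr> vecs = mats n n (vecs V),
    cone = (\<lambda>k. {X \<in> mats k k (mats n n (vecs V)). unblock k n X \<in> cone V (k * n)}) \<rparr>"

abbreviation mat_alg :: "nat \<Rightarrow> complex matrix mat_cones"
  where "mat_alg n \<equiv> mat_over n scalars"

text \<open>Functionals on a subspace are represented by functions vanishing outside of it.\<close>

definition dual :: "'v::complex_vector set \<Rightarrow> ('v \<Rightarrow> complex) set"
  where "dual V = {f. clinear_on V f \<and> (\<forall>x. x \<notin> V \<longrightarrow> f x = 0)}"

definition dual_sys :: "'v::complex_vector mat_cones \<Rightarrow> ('v \<Rightarrow> complex) mat_cones"
  where "dual_sys V = \<lparr> vecs = dual (vecs V), cone = (\<lambda>n. {F \<in> mats n n (dual (vecs V)).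
    completely_positive V (mat_alg n) (\<lambda>s i j. F i j s)}) \<rparr>"

text \<open>The norm of an \<open>m \<times> m\<close> matrix of operators on \<open>H\<close> as an operator on \<open>H\<^sup>m\<close>.\<close>

definition mat_norm :: "nat \<Rightarrow> 'h::complex_hilbert bop matrix \<Rightarrow> real"
  where "mat_norm m X = (SUP h\<in>{h. L2_set (\<lambda>j. norm (h j)) {..<m} \<le> 1}.
    L2_set (\<lambda>i. norm (\<Sum>j<m. bop_apply (X i j) (h j))) {..<m})"


section \<open>Algebraic tensor products\<close>

text \<open>The tensor product of two vector spaces is the free vector space on pairs modulo the subspace
  generated by the bilinearity relations.\<close>

definition pair :: "'a \<Rightarrow> 'b \<Rightarrow> ('a \<times> 'b) \<Rightarrow>\<^sub>0 complex"
  where "pair x y = Poly_Mapping.single (x, y) 1"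

definition tensor_relations ::
  "(('a::complex_vector \<times> 'b::complex_vector) \<Rightarrow>\<^sub>0 complex) set"
  where "tensor_relations =
    {pair (x + x') y - (pair x y + pair x' y) |x x' y. True} \<union>
    {pair x (y + y') - (pair x y + pair x y') |x y y'. True} \<union>
    {pair (c *\<^sub>C x) y - c *\<^sub>C pair x y |c x y. True} \<union>
    {pair x (c *\<^sub>C y) - c *\<^sub>C pair x y |c x y. True}"

definition tensor_eq :: "(('a::complex_vector \<times> 'b::complex_vector) \<Rightarrow>\<^sub>0 complex) \<Rightarrow>
    (('a \<times> 'b) \<Rightarrow>\<^sub>0 complex) \<Rightarrow> bool"
  where "tensor_eq u v \<longleftrightarrow> u - v \<in> complex_vector.span tensor_relations"

lemma equivp_tensor_eq:
  "equivp (tensor_eq :: (('a::complex_vector \<times> 'b::complex_vector) \<Rightarrow>\<^sub>0 complex) \<Rightarrow> _)"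
  (is "equivp ?R")
proof (rule equivpI)
  show "reflp ?R"
    by (rule reflpI) (simp add: tensor_eq_def complex_vector.span_zero)
  show "symp ?R"
    by (rule sympI) (metis tensor_eq_def complex_vector.span_neg minus_diff_eq)
  show "transp ?R"
  proof (rule transpI)
    fix u v w :: "('a \<times> 'b) \<Rightarrow>\<^sub>0 complex"
    assume "tensor_eq u v" "tensor_eq v w"
    then have "(u - v) + (v - w) \<in> complex_vector.span tensor_relations"
      unfolding tensor_eq_def by (rule complex_vector.span_add)
    then show "tensor_eq u w" by (simp add: tensor_eq_def)
  qed
qed

quotient_type (overloaded) ('a, 'b) tensor =
  "(('a::complex_vector \<times> 'b::complex_vector) \<Rightarrow>\<^sub>0 complex)" / tensor_eq
  by (rule equivp_tensor_eq)

instantiation tensor :: (complex_vector, complex_vector) complex_vector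
begin
lift_definition zero_tensor :: "('a, 'b) tensor" is 0 .
lift_definition plus_tensor :: "('a, 'b) tensor \<Rightarrow> ('a, 'b) tensor \<Rightarrow> ('a, 'b) tensor" is "(+)"
  unfolding tensor_eq_def add_diff_add by (rule complex_vector.span_add)
lift_definition uminus_tensor :: "('a, 'b) tensor \<Rightarrow> ('a, 'b) tensor" is uminus
  unfolding tensor_eq_def minus_diff_minus by (rule complex_vector.span_neg)
lift_definition minus_tensor :: "('a, 'b) tensor \<Rightarrow> ('a, 'b) tensor \<Rightarrow> ('a, 'b) tensor" is "(-)"
proof -
  fix u u' v v' :: "('a \<times> 'b) \<Rightarrow>\<^sub>0 complex"
  assume "tensor_eq u u'" "tensor_eq v v'"
  then have "(u - u') - (v - v') \<in> complex_vector.span tensor_relations"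
    unfolding tensor_eq_def by (rule complex_vector.span_diff)
  moreover have "(u - u') - (v - v') = (u - v) - (u' - v')" by (simp add: algebra_simps)
  ultimately show "tensor_eq (u - v) (u' - v')" by (simp add: tensor_eq_def)
qed
lift_definition scaleC_tensor :: "complex \<Rightarrow> ('a, 'b) tensor \<Rightarrow> ('a, 'b) tensor" is scaleC
  unfolding tensor_eq_def complex_vector.scale_right_diff_distrib[symmetric]
  by (rule complex_vector.span_scale)
instance
  by standard (transfer; simp add: tensor_eq_def complex_vector.span_zero algebra_simps
      scaleC_add_right scaleC_add_left scaleC_scaleC scaleC_one)+
end

lift_definition tens :: "'a::complex_vector \<Rightarrow> 'b::complex_vector \<Rightarrow> ('a, 'b) tensor"
  (infixl "\<otimes>\<^sub>t" 72) is pair .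

text \<open>\<open>V \<otimes> W\<close> for subspaces, as a subspace of the tensor product of the ambient spaces.\<close>

definition tensor_space ::
  "'a::complex_vector set \<Rightarrow> 'b::complex_vector set \<Rightarrow> ('a, 'b) tensor set"
  where "tensor_space V W = complex_vector.span {x \<otimes>\<^sub>t y |x y. x \<in> V \<and> y \<in> W}"

text \<open>The value \<open>\<Sum>\<^sub>i f(x\<^sub>i)y\<^sub>i\<close> at \<open>f\<close> of the map associated with \<open>u = \<Sum>\<^sub>i x\<^sub>i \<otimes> y\<^sub>i\<close>; lemma
  \<open>slice_sum_tens\<close> shows that it does not depend on the representation of \<open>u\<close>.\<close>

definition slice :: "'a::complex_vector set \<Rightarrow> 'b::complex_vector set \<Rightarrow>
    ('a, 'b) tensor \<Rightarrow> ('a \<Rightarrow> complex) \<Rightarrow> 'b"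
  where "slice V W u f = (THE z. \<exists>(n::nat) x y. (\<forall>i<n. x i \<in> V \<and> y i \<in> W) \<and>
    u = (\<Sum>i<n. x i \<otimes>\<^sub>t y i) \<and> z = (\<Sum>i<n. f (x i) *\<^sub>C y i))"

definition hat :: "'a::complex_vector set \<Rightarrow> 'b::complex_vector set \<Rightarrow>
    ('a, 'b) tensor matrix \<Rightarrow> ('a \<Rightarrow> complex) \<Rightarrow> 'b matrix"
  where "hat V W U f = (\<lambda>k l. slice V W (U k l) f)"


section \<open>The maximal tensor product\<close>

definition kron :: "nat \<Rightarrow> nat \<Rightarrow> 'a::complex_vector matrix \<Rightarrow> 'b::complex_vector matrix \<Rightarrow>
    ('a, 'b) tensor matrix"
  where "kron k r P Q = (\<lambda>p q. if p < k * r \<and> q < k * r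
    then P (p div r) (q div r) \<otimes>\<^sub>t Q (p mod r) (q mod r) else 0)"

text \<open>\<open>A X A\<^sup>*\<close> for \<open>A \<in> M\<^sub>n\<^sub>,\<^sub>d\<close> and a \<open>d \<times> d\<close> matrix \<open>X\<close> of vectors.\<close>

definition conjugate :: "nat \<Rightarrow> nat \<Rightarrow> complex matrix \<Rightarrow> 'v::complex_vector matrix \<Rightarrow> 'v matrix"
  where "conjugate n d A X = (\<lambda>i j. if i < n \<and> j < n
    then (\<Sum>p<d. \<Sum>q<d. (A i p * cnj (A j q)) *\<^sub>C X p q) else 0)"

definition D_max :: "'h::complex_hilbert bop set \<Rightarrow> 'k::complex_hilbert bop set \<Rightarrow> nat \<Rightarrow>
    ('h bop, 'k bop) tensor matrix set"
  where "D_max S T n = {conjugate n (k * r) A (kron k r P Q) |k r P Q A.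
    P \<in> cone (op_sys S) k \<and> Q \<in> cone (op_sys T) r \<and> A \<in> mats n (k * r) UNIV}"

definition max_tensor :: "'h::complex_hilbert bop set \<Rightarrow> 'k::complex_hilbert bop set \<Rightarrow>
    ('h bop, 'k bop) tensor mat_cones"
  where "max_tensor S T = \<lparr> vecs = tensor_space S T,
    cone = (\<lambda>n. {U \<in> mats n n (tensor_space S T). \<forall>\<epsilon>>0.
      (\<lambda>i j. (if i = j \<and> i < n then complex_of_real \<epsilon> *\<^sub>C (1 \<otimes>\<^sub>t 1) else 0) + U i j)
        \<in> D_max S T n}) \<rparr>"


section \<open>Nets\<close>

text \<open>A net is indexed by a directed subset of an arbitrary type. Since HOL cannot quantify
  existentially over types, ``there is a net'' is stated with a type of indices that is universally
  quantified and only required to be infinite; its directed subsets include copies of the natural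
  numbers and of all finite directed sets.\<close>

definition directed_set :: "'i set \<Rightarrow> ('i \<times> 'i) set \<Rightarrow> bool"
  where "directed_set I r \<longleftrightarrow> I \<noteq> {} \<and> preorder_on I r \<and>
    (\<forall>i\<in>I. \<forall>j\<in>I. \<exists>k\<in>I. (i, k) \<in> r \<and> (j, k) \<in> r)"

text \<open>The filter generated by the tails of a directed set.\<close>

definition tails :: "'i set \<Rightarrow> ('i \<times> 'i) set \<Rightarrow> 'i filter"
  where "tails I r = (INF i\<in>I. principal {j \<in> I. (i, j) \<in> r})"

lemma eventually_tails:
  assumes "directed_set I r"
  shows "eventually P (tails I r) \<longleftrightarrow> (\<exists>i\<in>I. \<forall>j\<in>I. (i, j) \<in> r \<longrightarrow> P j)"
proof -
  have tr: "trans r" using assms by (simp add: directed_set_def preorder_on_def)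
  have "eventually P (tails I r) \<longleftrightarrow>
      (\<exists>i\<in>I. eventually P (principal {j \<in> I. (i, j) \<in> r}))"
    unfolding tails_def
  proof (rule eventually_INF_base)
    show "I \<noteq> {}" using assms by (simp add: directed_set_def)
    fix a b assume "a \<in> I" "b \<in> I"
    then obtain k where "k \<in> I" "(a, k) \<in> r" "(b, k) \<in> r"
      using assms unfolding directed_set_def by blast
    then show "\<exists>x\<in>I. principal {j \<in> I. (x, j) \<in> r} \<le>
        inf (principal {j \<in> I. (a, j) \<in> r}) (principal {j \<in> I. (b, j) \<in> r})"
      using tr by (intro bexI[of _ k]) (auto dest: transD)
  qed
  then show ?thesis by (auto simp: eventually_principal)
qed


section \<open>Well-definedness of slices\<close>

definition free_eval :: "('a::complex_vector \<Rightarrow> 'b::complex_vector \<Rightarrow> 'c::complex_vector) \<Rightarrow>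
    (('a \<times> 'b) \<Rightarrow>\<^sub>0 complex) \<Rightarrow> 'c"
  where "free_eval h u = (\<Sum>p\<in>Poly_Mapping.keys u. Poly_Mapping.lookup u p *\<^sub>C h (fst p) (snd p))"

lemma free_eval_superset:
  assumes "finite K" "Poly_Mapping.keys u \<subseteq> K"
  shows "free_eval h u = (\<Sum>p\<in>K. Poly_Mapping.lookup u p *\<^sub>C h (fst p) (snd p))"
  unfolding free_eval_def using assms
  by (intro sum.mono_neutral_left) (auto simp: in_keys_iff)

lemma free_eval_add: "free_eval h (u + v) = free_eval h u + free_eval h v"
proof -
  let ?K = "Poly_Mapping.keys u \<union> Poly_Mapping.keys v"
  have "free_eval h (u + v) = (\<Sum>p\<in>?K. Poly_Mapping.lookup (u + v) p *\<^sub>C h (fst p) (snd p))"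
    using Poly_Mapping.keys_add[of u v] by (intro free_eval_superset) auto
  also have "\<dots> = (\<Sum>p\<in>?K. Poly_Mapping.lookup u p *\<^sub>C h (fst p) (snd p)) + (\<Sum>p\<in>?K. Poly_Mapping.lookup v p *\<^sub>C h (fst p) (snd p))"
    by (simp add: lookup_add scaleC_add_left sum.distrib)
  also have "\<dots> = free_eval h u + free_eval h v"
    by (simp add: free_eval_superset[of ?K])
  finally show ?thesis .
qed

lemma free_eval_scaleC: "free_eval h (c *\<^sub>C u) = c *\<^sub>C free_eval h u"
proof -
  have l: "Poly_Mapping.lookup (c *\<^sub>C u) p = c * Poly_Mapping.lookup u p" for p
    by (simp add: scaleC_poly_mapping.rep_eq scaleC_complex_def)
  have "free_eval h (c *\<^sub>C u) = (\<Sum>p\<in>Poly_Mapping.keys u. Poly_Mapping.lookup (c *\<^sub>C u) p *\<^sub>C h (fst p) (snd p))"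
    by (rule free_eval_superset) (auto simp: in_keys_iff l)
  then show ?thesis
    by (simp add: l free_eval_def complex_vector.scale_sum_right scaleC_scaleC)
qed

lemma free_eval_diff: "free_eval h (u - v) = free_eval h u - free_eval h v"
  using free_eval_add[of h "u - v" v] by (simp add: algebra_simps)

lemma free_eval_pair: "free_eval h (pair x y) = h x y"
  by (simp add: free_eval_def pair_def scaleC_one)

lemma free_eval_tensor_eq:
  assumes add1: "\<And>x x' y. h (x + x') y = h x y + h x' y"
    and add2: "\<And>x y y'. h x (y + y') = h x y + h x y'"
    and sc1: "\<And>c x y. h (c *\<^sub>C x) y = c *\<^sub>C h x y"
    and sc2: "\<And>c x y. h x (c *\<^sub>C y) = c *\<^sub>C h x y"
    and eq: "tensor_eq u v"
  shows "free_eval h u = free_eval h v"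
proof -
  have z: "free_eval h 0 = 0" by (simp add: free_eval_def)
  have "u - v \<in> complex_vector.span tensor_relations" using eq by (simp add: tensor_eq_def)
  then have "free_eval h (u - v) = 0"
  proof (induction rule: complex_vector.span_induct_alt)
    case base show ?case by (rule z)
  next
    case (step c x y)
    have "free_eval h x = 0"
      using step(1) unfolding tensor_relations_def
      by (auto simp: free_eval_add free_eval_diff free_eval_scaleC free_eval_pair add1 add2 sc1 sc2)
    then show ?case using step by (simp add: free_eval_add free_eval_scaleC)
  qed
  then show ?thesis by (simp add: free_eval_diff)
qed

lemma slice_sum_tens:
  fixes x :: "nat \<Rightarrow> 'a::complex_vector" and y :: "nat \<Rightarrow> 'b::complex_vector"
  assumes V: "complex_vector.subspace V" and f: "f \<in> dual V"
    and xy: "\<And>i. i < n \<Longrightarrow> x i \<in> V \<and> y i \<in> W"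
  shows "slice V W (\<Sum>i<n. x i \<otimes>\<^sub>t y i) f = (\<Sum>i<n. f (x i) *\<^sub>C y i)"
proof -
  interpret vp: vector_space_pair "scaleC :: complex \<Rightarrow> 'a \<Rightarrow> 'a" "scaleC :: complex \<Rightarrow> complex \<Rightarrow> complex"
    by unfold_locales
  have lin: "\<And>x y. x \<in> V \<Longrightarrow> y \<in> V \<Longrightarrow> f (x + y) = f x + f y"
    "\<And>c x. x \<in> V \<Longrightarrow> f (c *\<^sub>C x) = c *\<^sub>C f x"
    using f by (auto simp: dual_def clinear_on_def)
  obtain B where B: "B \<subseteq> V" "complex_vector.independent B" "V \<subseteq> complex_vector.span B"
    using complex_vector.maximal_independent_subset by blast
  obtain g where g: "Vector_Spaces.linear scaleC scaleC g" and gB: "\<forall>x\<in>B. g x = f x"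
    using vp.linear_independent_extend[OF B(2)] by blast
  interpret g: Vector_Spaces.linear "scaleC :: complex \<Rightarrow> 'a \<Rightarrow> 'a"
    "scaleC :: complex \<Rightarrow> complex \<Rightarrow> complex" g by (rule g)
  have gf: "g x = f x" if "x \<in> V" for x
  proof -
    have "x \<in> complex_vector.span B" using that B(3) by blast
    then have "x \<in> V \<and> g x = f x"
    proof (induction rule: complex_vector.span_induct_alt)
      case base
      have "f (0 *\<^sub>C 0) = 0 *\<^sub>C f 0" by (rule lin(2)) (rule complex_vector.subspace_0[OF V])
      then show ?case using complex_vector.subspace_0[OF V] by (simp add: g.zero)
    next
      case (step c b z)
      have b: "b \<in> V" using step B(1) by blast
      then have cb: "c *\<^sub>C b \<in> V" by (rule complex_vector.subspace_scale[OF V])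
      have "c *\<^sub>C b + z \<in> V" using step cb by (auto intro: complex_vector.subspace_add[OF V])
      moreover have "g (c *\<^sub>C b + z) = f (c *\<^sub>C b + z)"
        using step gB by (simp add: g.add g.scale lin b cb)
      ultimately show ?case ..
    qed
    then show ?thesis ..
  qed
  define h where "h x y = g x *\<^sub>C (y :: 'b)" for x y
  have ev: "free_eval h (\<Sum>i<n. pair (x i) (y i)) = (\<Sum>i<n. h (x i) (y i))" for n :: nat and x y
    by (induction n) (simp_all add: free_eval_add free_eval_pair, simp add: free_eval_def)
  have ab: "(\<Sum>i<n. x i \<otimes>\<^sub>t y i) = abs_tensor (\<Sum>i<n. pair (x i) (y i))"
    for n :: nat and x :: "nat \<Rightarrow> 'a" and y :: "nat \<Rightarrow> 'b"
    by (induction n) (simp_all add: zero_tensor.abs_eq tens.abs_eq plus_tensor.abs_eq)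
  have main: "z = (\<Sum>i<n. f (x i) *\<^sub>C y i)"
    if r: "\<forall>i<n'. x' i \<in> V \<and> y' i \<in> W" and eq: "(\<Sum>i<n. x i \<otimes>\<^sub>t y i) = (\<Sum>i<n'. x' i \<otimes>\<^sub>t y' i)"
      and z: "z = (\<Sum>i<n'. f (x' i) *\<^sub>C y' i)" for z x' y' and n' :: nat
  proof -
    have "tensor_eq (\<Sum>i<n. pair (x i) (y i)) (\<Sum>i<n'. pair (x' i) (y' i))"
      using eq by (simp add: ab tensor.abs_eq_iff)
    then have "free_eval h (\<Sum>i<n. pair (x i) (y i)) = free_eval h (\<Sum>i<n'. pair (x' i) (y' i))"
      by (rule free_eval_tensor_eq[rotated 4])
        (simp_all add: h_def g.add g.scale scaleC_add_left scaleC_add_right scaleC_scaleC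
          scaleC_complex_def mult.commute)
    then have "(\<Sum>i<n. g (x i) *\<^sub>C y i) = (\<Sum>i<n'. g (x' i) *\<^sub>C y' i)"
      by (simp add: ev h_def)
    moreover have "(\<Sum>i<n. g (x i) *\<^sub>C y i) = (\<Sum>i<n. f (x i) *\<^sub>C y i)"
      using xy by (intro sum.cong) (auto simp: gf)
    moreover have "(\<Sum>i<n'. g (x' i) *\<^sub>C y' i) = (\<Sum>i<n'. f (x' i) *\<^sub>C y' i)"
      using r by (intro sum.cong) (auto simp: gf)
    ultimately show ?thesis using z by simp
  qed
  show ?thesis
    unfolding slice_def
  proof (rule the_equality)
    show "\<exists>(m::nat) x' y'. (\<forall>i<m. x' i \<in> V \<and> y' i \<in> W) \<and>
        (\<Sum>i<n. x i \<otimes>\<^sub>t y i) = (\<Sum>i<m. x' i \<otimes>\<^sub>t y' i) \<and>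
        (\<Sum>i<n. f (x i) *\<^sub>C y i) = (\<Sum>i<m. f (x' i) *\<^sub>C y' i)"
      using xy by (intro exI[of _ n] exI[of _ x] exI[of _ y]) auto
  next
    fix z assume "\<exists>(m::nat) x' y'. (\<forall>i<m. x' i \<in> V \<and> y' i \<in> W) \<and>
        (\<Sum>i<n. x i \<otimes>\<^sub>t y i) = (\<Sum>i<m. x' i \<otimes>\<^sub>t y' i) \<and> z = (\<Sum>i<m. f (x' i) *\<^sub>C y' i)"
    then show "z = (\<Sum>i<n. f (x i) *\<^sub>C y i)" using main by blast
  qed
qed

end

theory Submission
  imports Defs
begin

text \<open>Positivity is handled throughout by quadratic forms, without square roots or spectral
  theory. This decides the shape of the one hard positivity claim: for
  \<open>X -> A (X \<otimes> Q) A^*\<close> the matrix \<open>Q\<close> is compressed to a scalar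
  matrix Y of inner products, and what remains is \<Sum> X_st Y_st \<ge> 0 for positive scalar
  matrices X and Y (\<open>trace_product_nonneg\<close>). In the converse direction, norm-closeness
  alone is not enough: the absorbing argument needs self-adjoint w_a, while U is an arbitrary matrix
  over the tensor space. Self-adjointness is therefore first shown for the approximants, where it
  comes from Hermitian pairings, and then passed to U in the limit. Pointwise convergence suffices
  because U is recovered from the values of its map at the finitely many coordinate functionals e_a.
  The last step, U_\<lambda> + (\<epsilon> 1 + U - U_\<lambda>), rests on \<open>D_max\<close> being
  closed under addition, which is a direct sum construction.\<close>

text \<open>An element of the form \<open>A (P \<otimes> Q) A\<^sup>*\<close> corresponds to the composition of the completely
  positive maps \<open>f \<mapsto> [f(p\<^sub>i\<^sub>j)]\<close> and \<open>X \<mapsto> A (X \<otimes> Q) A\<^sup>*\<close>. Applied to \<open>\<epsilon> 1 + U\<close> with \<open>\<epsilon> \<rightarrow> 0\<close>, this gives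
  the factorizations of a positive \<open>U\<close>. Conversely, a completely positive map from \<open>S\<^sup>d\<close> to \<open>M\<^sub>n\<close> is
  evaluation at a positive matrix over \<open>S\<close>, and a completely positive map on \<open>M\<^sub>n\<close> is given by its
  positive Choi matrix, so a factorization yields a \<open>U\<^sub>\<lambda>\<close> in the cone \<open>D_max\<close>. If \<open>U\<^sub>\<lambda>\<close> is close to
  \<open>U\<close>, then \<open>\<epsilon> 1 + U - U\<^sub>\<lambda>\<close> is in \<open>D_max\<close> as well: it is \<open>\<epsilon> 1 + \<Sum>\<^sub>a s\<^sub>a \<otimes> w\<^sub>a\<close> for a self-adjoint basis
  \<open>s\<^sub>a\<close> of \<open>S\<close> and small self-adjoint \<open>w\<^sub>a\<close>.\<close>

section \<open>Inner products and operators\<close>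

lemma cinner_add_right: "cinner x (y + z) = cinner x y + cinner x (z::'a::complex_hilbert)"
  by (metis cinner_add_left cinner_commute complex_cnj_add)

lemma cinner_scaleC_right: "cinner x (c *\<^sub>C y) = cnj c * cinner x (y::'a::complex_hilbert)"
  by (metis cinner_commute cinner_scaleC_left complex_cnj_mult)

lemma cinner_zero_left [simp]: "cinner 0 (y::'a::complex_hilbert) = 0"
  using cinner_add_left[of 0 0 y] by simp

lemma cinner_zero_right [simp]: "cinner x (0::'a::complex_hilbert) = 0"
  using cinner_add_right[of x 0 0] by simp

lemma cinner_diff_left: "cinner (x - y) z = cinner x z - cinner y (z::'a::complex_hilbert)"
  using cinner_add_left[of "x - y" y z] by simp

lemma cinner_sum_left: "cinner (\<Sum>i\<in>I. f i) y = (\<Sum>i\<in>I. cinner (f i) (y::'a::complex_hilbert))"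
  by (induction I rule: infinite_finite_induct) (simp_all add: cinner_add_left)

lemma cinner_sum_right: "cinner x (\<Sum>i\<in>I. f i) = (\<Sum>i\<in>I. cinner x (f i :: 'a::complex_hilbert))"
  by (induction I rule: infinite_finite_induct) (simp_all add: cinner_add_right)

lemma norm_scaleC: "norm (c *\<^sub>C x) = cmod c * norm (x::'a::complex_hilbert)"
proof -
  have "complex_of_real ((norm (c *\<^sub>C x))\<^sup>2) = c * cnj c * complex_of_real ((norm x)\<^sup>2)"
    by (simp only: cinner_self[symmetric] cinner_scaleC_left cinner_scaleC_right ac_simps)
  also have "\<dots> = complex_of_real ((cmod c * norm x)\<^sup>2)"
    by (simp only: complex_norm_square[symmetric] power_mult_distrib of_real_mult)
  finally have "(norm (c *\<^sub>C x))\<^sup>2 = (cmod c * norm x)\<^sup>2"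
    by (simp only: of_real_eq_iff)
  then show ?thesis by (subst (asm) power2_eq_iff_nonneg) simp_all
qed

lemma cinner_eq_zeroI: "(\<And>y. cinner x y = 0) \<Longrightarrow> x = (0::'a::complex_hilbert)"
  by (metis cinner_self norm_eq_zero of_real_eq_0_iff zero_eq_power2)

text \<open>Pythagoras for x = (x - c y) + c y, where c y is the orthogonal projection of x onto the
  line of y; the second square alone gives the bound.\<close>

lemma cmod_cinner_le: "cmod (cinner x y) \<le> norm x * norm (y::'a::complex_hilbert)"
proof (cases "y = 0")
  case False
  define c where "c = cinner x y / cinner y y"
  have yy: "cinner y y \<noteq> 0" using False by (simp add: cinner_self)
  have cyy: "c * cinner y y = cinner x y" using yy by (simp add: c_def)
  have "complex_of_real ((norm x)\<^sup>2) = cinner ((x - c *\<^sub>C y) + c *\<^sub>C y) ((x - c *\<^sub>C y) + c *\<^sub>C y)"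
    by (simp add: cinner_self)
  also have "\<dots> = cinner (x - c *\<^sub>C y) (x - c *\<^sub>C y) + cinner (c *\<^sub>C y) (c *\<^sub>C y)"
  proof -
    have "cinner (x - c *\<^sub>C y) (c *\<^sub>C y) = 0"
      by (simp add: cinner_diff_left cinner_scaleC_left cinner_scaleC_right cyy algebra_simps)
    moreover then have "cinner (c *\<^sub>C y) (x - c *\<^sub>C y) = 0"
      by (metis cinner_commute complex_cnj_zero)
    ultimately show ?thesis by (simp only: cinner_add_left cinner_add_right) simp
  qed
  also have "\<dots> = complex_of_real ((norm (x - c *\<^sub>C y))\<^sup>2 + (cmod c * norm y)\<^sup>2)"
    by (simp only: cinner_self norm_scaleC of_real_add)
  finally have "(norm x)\<^sup>2 = (norm (x - c *\<^sub>C y))\<^sup>2 + (cmod c * norm y)\<^sup>2"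
    by (simp only: of_real_eq_iff)
  then have "(cmod c * norm y)\<^sup>2 \<le> (norm x)\<^sup>2" by simp
  then have "cmod c * norm y \<le> norm x" by (rule power2_le_imp_le) simp
  moreover have "cmod (cinner x y) = cmod c * norm y * norm y"
    by (simp add: cyy[symmetric] norm_mult cinner_self power2_eq_square)
  ultimately show ?thesis by (simp add: mult_right_mono)
qed simp

section \<open>Evaluation rules for bounded operators\<close>

lemma bop_eqI: "(\<And>x. bop_apply A x = bop_apply B x) \<Longrightarrow> A = B"
  by (simp add: bop_apply_inject[symmetric] fun_eq_iff)

lemma bounded_linear_bop: "bounded_linear (bop_apply A)"
  using bop_apply[of A] by simp

lemma bop_scale_right: "bop_apply A (c *\<^sub>C x) = c *\<^sub>C bop_apply A x"
  using bop_apply[of A] by simp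

lemma bop_add_right: "bop_apply A (x + y) = bop_apply A x + bop_apply A y"
  by (simp add: linear_add bounded_linear.linear bounded_linear_bop)

lemma bop_zero_right [simp]: "bop_apply A 0 = 0"
  by (simp add: linear_0 bounded_linear.linear bounded_linear_bop)

lemma bop_sum_right: "bop_apply A (\<Sum>i\<in>I. f i) = (\<Sum>i\<in>I. bop_apply A (f i))"
  by (simp add: linear_sum bounded_linear.linear bounded_linear_bop)

lemma bop_sum_left: "bop_apply (\<Sum>i\<in>I. f i) x = (\<Sum>i\<in>I. bop_apply (f i) x)"
  by (induction I rule: infinite_finite_induct) (simp_all add: zero_bop.rep_eq plus_bop.rep_eq)

lemmas bop_simps = zero_bop.rep_eq one_bop.rep_eq plus_bop.rep_eq minus_bop.rep_eq
  uminus_bop.rep_eq scaleC_bop.rep_eq bop_sum_left bop_sum_right bop_scale_right bop_add_right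
lemmas cinner_simps = cinner_add_left cinner_add_right cinner_diff_left cinner_scaleC_left
  cinner_scaleC_right cinner_sum_left cinner_sum_right

section \<open>Matrices and their quadratic forms\<close>

lemma sum_single:
  fixes f :: "'a \<Rightarrow> 'b::comm_monoid_add"
  assumes "finite A" "s \<in> A" "\<And>i. i \<in> A \<Longrightarrow> i \<noteq> s \<Longrightarrow> f i = 0"
  shows "sum f A = f s"
  using assms by (subst sum.remove[of A s]) auto

lemma sum_lessThan_add:
  fixes g :: "nat \<Rightarrow> 'a::comm_monoid_add"
  shows "(\<Sum>i<k + l. g i) = (\<Sum>i<k. g i) + (\<Sum>i<l. g (k + i))"
  by (induction l) (simp_all add: add.assoc)

text \<open>Splits a flat index as \<open>i * n + a\<close>, the convention behind the
  \<open>div\<close> and \<open>mod\<close> in \<open>unblock\<close> and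
  \<open>kron\<close>.\<close>

lemma sum_blocks:
  fixes g :: "nat \<Rightarrow> 'a::comm_monoid_add"
  shows "(\<Sum>p<k * n. g p) = (\<Sum>i<k. \<Sum>a<n. g (i * n + a))"
proof -
  have "(\<Sum>p\<in>{i * n..<i * n + n}. g p) = (\<Sum>a<n. g (i * n + a))" for i
    using sum.shift_bounds_nat_ivl[of g 0 "i * n" n]
    by (simp add: add.commute lessThan_atLeast0)
  then show ?thesis by (simp flip: sum.nat_group)
qed

lemma block_index_less: "i < k \<Longrightarrow> a < n \<Longrightarrow> i * n + a < k * (n::nat)"
proof -
  assume "i < k" "a < n"
  then have "i * n + a < Suc i * n" by simp
  also have "\<dots> \<le> k * n" using \<open>i < k\<close> by (intro mult_right_mono) auto
  finally show ?thesis .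
qed

lemma unblock_index:
  "i < k \<Longrightarrow> j < k \<Longrightarrow> a < n \<Longrightarrow> b < n \<Longrightarrow> unblock k n X (i * n + a) (j * n + b) = X i j a b"
  by (simp add: unblock_def block_index_less)

lemma matsI:
  assumes "\<And>i j. i < n \<Longrightarrow> j < k \<Longrightarrow> X i j \<in> V" "\<And>i j. \<not> (i < n \<and> j < k) \<Longrightarrow> X i j = 0"
  shows "X \<in> mats n k V"
  using assms by (simp add: mats_def)

lemma mats_in: "X \<in> mats n k V \<Longrightarrow> i < n \<Longrightarrow> j < k \<Longrightarrow> X i j \<in> V"
  unfolding mats_def mem_Collect_eq by metis

lemma mats_zero: "X \<in> mats n k V \<Longrightarrow> \<not> (i < n \<and> j < k) \<Longrightarrow> X i j = 0"
  unfolding mats_def mem_Collect_eq by metis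

lemma mats_in_subspace:
  assumes "complex_vector.subspace V" "X \<in> mats n k V" shows "X i j \<in> V"
  using mats_in[OF assms(2)] mats_zero[OF assms(2)] complex_vector.subspace_0[OF assms(1)]
  by (cases "i < n \<and> j < k") auto

text \<open>This is <X h, h> on the n-fold sum of H, the quantity by which \<open>op_sys\<close>
  declares X positive. Working with it avoids turning that sum into a Hilbert space of its
  own.\<close>

definition opform :: "nat \<Rightarrow> 'h::complex_hilbert bop matrix \<Rightarrow> (nat \<Rightarrow> 'h) \<Rightarrow> complex"
  where "opform n X h = (\<Sum>i<n. \<Sum>j<n. cinner (bop_apply (X i j) (h j)) (h i))"

definition form :: "nat \<Rightarrow> complex matrix \<Rightarrow> (nat \<Rightarrow> complex) \<Rightarrow> complex"
  where "form n X v = (\<Sum>i<n. \<Sum>j<n. cnj (v i) * X i j * v j)"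

lemma cone_op_sys: "X \<in> cone (op_sys S) n \<longleftrightarrow> X \<in> mats n n S \<and> (\<forall>h. opform n X h \<in> \<real>\<^sub>\<ge>\<^sub>0)"
  by (simp add: op_sys_def opform_def)

lemma cone_op_sys_mats: "X \<in> cone (op_sys S) n \<Longrightarrow> X \<in> mats n n S"
  by (simp add: cone_op_sys)

lemma vecs_op_sys [simp]: "vecs (op_sys S) = S"
  by (simp add: op_sys_def)

lemma vecs_mat_over [simp]: "vecs (mat_over n V) = mats n n (vecs V)"
  by (simp add: mat_over_def)

lemma vecs_scalars [simp]: "vecs scalars = UNIV"
  by (simp add: scalars_def)

lemma vecs_dual_sys [simp]: "vecs (dual_sys V) = dual (vecs V)"
  by (simp add: dual_sys_def)

lemma vecs_max_tensor [simp]: "vecs (max_tensor S T) = tensor_space S T"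
  by (simp add: max_tensor_def)

lemma unblock_mats:
  assumes "X \<in> mats k k (mats n n V)" shows "unblock k n X \<in> mats (k * n) (k * n) V"
proof -
  have "X i j a b \<in> V" if "i < k" "j < k" "a < n" "b < n" for i j a b
    using assms that unfolding mats_def mem_Collect_eq by metis
  moreover have "p div n < k" "p mod n < n" if "p < k * n" for p
  proof -
    show "p div n < k" using that by (simp add: less_mult_imp_div_less)
    have "n > 0" using that by (cases n) auto
    then show "p mod n < n" by simp
  qed
  ultimately show ?thesis by (auto simp: mats_def unblock_def)
qed

text \<open>Test vectors of length k * n become families with two indices, so that
  \<open>unblock\<close> with its \<open>div\<close> and \<open>mod\<close> disappears from the
  later arguments.\<close>

lemma cone_mat_alg:
  "X \<in> cone (mat_alg n) k \<longleftrightarrow> X \<in> mats k k (mats n n UNIV) \<and>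
    (\<forall>v. (\<Sum>i<k. \<Sum>a<n. \<Sum>j<k. \<Sum>b<n. cnj (v i a) * X i j a b * v j b) \<in> \<real>\<^sub>\<ge>\<^sub>0)"
proof (cases "X \<in> mats k k (mats n n (UNIV :: complex set))")
  case True
  have eq: "form (k * n) (unblock k n X) v =
      (\<Sum>i<k. \<Sum>a<n. \<Sum>j<k. \<Sum>b<n. cnj (v (i * n + a)) * X i j a b * v (j * n + b))" for v
    by (auto simp: form_def sum_blocks unblock_index intro!: sum.cong)
  have "(\<forall>v. form (k * n) (unblock k n X) v \<in> \<real>\<^sub>\<ge>\<^sub>0) \<longleftrightarrow>
    (\<forall>v. (\<Sum>i<k. \<Sum>a<n. \<Sum>j<k. \<Sum>b<n. cnj (v i a) * X i j a b * v j b) \<in> \<real>\<^sub>\<ge>\<^sub>0)"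
  proof safe
    fix v assume "\<forall>v. form (k * n) (unblock k n X) v \<in> \<real>\<^sub>\<ge>\<^sub>0"
    then have "form (k * n) (unblock k n X) (\<lambda>p. v (p div n) (p mod n)) \<in> \<real>\<^sub>\<ge>\<^sub>0" by blast
    then show "(\<Sum>i<k. \<Sum>a<n. \<Sum>j<k. \<Sum>b<n. cnj (v i a) * X i j a b * v j b) \<in> \<real>\<^sub>\<ge>\<^sub>0"
      by (simp add: eq cong: sum.cong_simp)
  next
    fix v assume "\<forall>v. (\<Sum>i<k. \<Sum>a<n. \<Sum>j<k. \<Sum>b<n. cnj (v i a) * X i j a b * v j b) \<in> \<real>\<^sub>\<ge>\<^sub>0"
    then show "form (k * n) (unblock k n X) v \<in> \<real>\<^sub>\<ge>\<^sub>0" unfolding eq by (rule allE)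
  qed
  then show ?thesis using True unblock_mats[OF True]
    by (simp add: mat_over_def scalars_def form_def)
qed (simp add: mat_over_def scalars_def)

lemma cone_mat_over_op_sys:
  "X \<in> cone (mat_over n (op_sys T)) k \<longleftrightarrow> X \<in> mats k k (mats n n T) \<and>
    (\<forall>h. (\<Sum>i<k. \<Sum>a<n. \<Sum>j<k. \<Sum>b<n. cinner (bop_apply (X i j a b) (h j b)) (h i a)) \<in> \<real>\<^sub>\<ge>\<^sub>0)"
proof (cases "X \<in> mats k k (mats n n T)")
  case True
  have eq: "opform (k * n) (unblock k n X) h =
      (\<Sum>i<k. \<Sum>a<n. \<Sum>j<k. \<Sum>b<n. cinner (bop_apply (X i j a b) (h (j * n + b))) (h (i * n + a)))" for h
    by (auto simp: opform_def sum_blocks unblock_index intro!: sum.cong)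
  have "(\<forall>h. opform (k * n) (unblock k n X) h \<in> \<real>\<^sub>\<ge>\<^sub>0) \<longleftrightarrow>
    (\<forall>h. (\<Sum>i<k. \<Sum>a<n. \<Sum>j<k. \<Sum>b<n. cinner (bop_apply (X i j a b) (h j b)) (h i a)) \<in> \<real>\<^sub>\<ge>\<^sub>0)"
  proof safe
    fix h assume "\<forall>h. opform (k * n) (unblock k n X) h \<in> \<real>\<^sub>\<ge>\<^sub>0"
    then have "opform (k * n) (unblock k n X) (\<lambda>p. h (p div n) (p mod n)) \<in> \<real>\<^sub>\<ge>\<^sub>0" by blast
    then show "(\<Sum>i<k. \<Sum>a<n. \<Sum>j<k. \<Sum>b<n. cinner (bop_apply (X i j a b) (h j b)) (h i a)) \<in> \<real>\<^sub>\<ge>\<^sub>0"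
      by (simp add: eq cong: sum.cong_simp)
  next
    fix h assume "\<forall>h. (\<Sum>i<k. \<Sum>a<n. \<Sum>j<k. \<Sum>b<n. cinner (bop_apply (X i j a b) (h j b)) (h i a)) \<in> \<real>\<^sub>\<ge>\<^sub>0"
    then show "opform (k * n) (unblock k n X) h \<in> \<real>\<^sub>\<ge>\<^sub>0" unfolding eq by (rule allE)
  qed
  then show ?thesis using True unblock_mats[OF True]
    by (simp add: mat_over_def cone_op_sys)
qed (simp add: mat_over_def)

section \<open>Positive scalar matrices\<close>

lemma form_two:
  assumes "s < n" "t < n" "s \<noteq> t"
  shows "form n X (\<lambda>i. if i = s then x else if i = t then y else 0) =
    cnj x * X s s * x + cnj x * X s t * y + cnj y * X t s * x + cnj y * X t t * y"
proof -
  let ?v = "\<lambda>i. if i = s then x else if i = t then y else 0"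
  have inner: "(\<Sum>j<n. cnj (?v i) * X i j * ?v j) = cnj (?v i) * X i s * x + cnj (?v i) * X i t * y" for i
  proof -
    have "(\<Sum>j<n. cnj (?v i) * X i j * ?v j) = (\<Sum>j\<in>{s, t}. cnj (?v i) * X i j * ?v j)"
      using assms by (intro sum.mono_neutral_right) auto
    then show ?thesis using assms by simp
  qed
  have "form n X ?v = (\<Sum>i\<in>{s, t}. cnj (?v i) * X i s * x + cnj (?v i) * X i t * y)"
    unfolding form_def inner using assms by (intro sum.mono_neutral_right) auto
  then show ?thesis using assms by simp
qed

lemma form_one:
  assumes "s < n"
  shows "form n X (\<lambda>i. if i = s then x else 0) = cnj x * X s s * x"
proof -
  have "form n X (\<lambda>i. if i = s then x else 0) = (\<Sum>i<n. if i = s then cnj x * X s s * x else 0)"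
    unfolding form_def
    by (rule sum.cong[OF refl], subst sum_single[of _ s]) (use assms in auto)
  then show ?thesis using assms by simp
qed

text \<open>Polarization: the entries (1, 1) at the places s, t show that X s t + X t s is real, and
  the entries (1, \<i>) that X s t - X t s is imaginary.\<close>

lemma form_real_imp_hermitian:
  assumes "\<And>v. form n X v \<in> \<real>" and s: "s < n" and t: "t < n"
  shows "X t s = cnj (X s t)"
proof -
  have d: "X i i \<in> \<real>" if "i < n" for i
    using assms(1)[of "\<lambda>j. if j = i then 1 else 0"] that by (simp add: form_one)
  show ?thesis
  proof (cases "s = t")
    case True then show ?thesis using d[OF s] by (simp add: complex_is_Real_iff complex_eq_iff)
  next
    case False
    have "form n X (\<lambda>i. if i = s then 1 else if i = t then 1 else 0) \<in> \<real>"
      "form n X (\<lambda>i. if i = s then 1 else if i = t then \<i> else 0) \<in> \<real>" by (rule assms)+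
    then show ?thesis using d[OF s] d[OF t]
      unfolding form_two[OF s t False] by (simp add: complex_is_Real_iff complex_eq_iff)
  qed
qed

lemma form_nonneg_zero_diag:
  assumes pos: "\<And>v. form n X v \<in> \<real>\<^sub>\<ge>\<^sub>0" and s: "s < n" and t: "t < n" and z: "X t t = 0"
  shows "X s t = 0"
proof (rule ccontr)
  assume nz: "X s t \<noteq> 0"
  then have st: "s \<noteq> t" using z by auto
  have h: "X t s = cnj (X s t)"
    by (rule form_real_imp_hermitian[OF _ s t]) (use pos nonneg_Reals_subset_Reals in blast)
  \<comment> \<open>Chosen such that the form at the vector with entries 1 and
    \<open>- r * cnj (X s t)\<close> has real part -1, whatever X s s is.\<close>
  define r where "r = (Re (X s s) + 1) / (2 * (cmod (X s t))\<^sup>2)"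
  have "form n X (\<lambda>i. if i = s then 1 else if i = t then - of_real r * cnj (X s t) else 0) =
    X s s - of_real r * (X s t * cnj (X s t)) - of_real r * (X s t * cnj (X s t))"
    unfolding form_two[OF s t st] by (simp add: z h algebra_simps)
  also have "\<dots> = X s s - of_real (2 * r * (cmod (X s t))\<^sup>2)"
    unfolding complex_norm_square[symmetric] by simp
  also have "2 * r * (cmod (X s t))\<^sup>2 = Re (X s s) + 1" using nz by (simp add: r_def)
  finally have "X s s - of_real (Re (X s s) + 1) \<in> \<real>\<^sub>\<ge>\<^sub>0" using pos by metis
  then show False by (simp add: complex_nonneg_Reals_iff)
qed

text \<open>The expansion needed to complete the square in the coordinate s.\<close>

lemma form_add_single:
  assumes "s < n"
  shows "form n X (\<lambda>i. v i + (if i = s then a else 0)) = form n X v + cnj a * (\<Sum>j<n. X s j * v j)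
    + (\<Sum>i<n. cnj (v i) * X i s) * a + cnj a * X s s * a"
proof -
  have inner: "(\<Sum>j<n. c i * X i j * (v j + (if j = s then a else 0))) =
      (\<Sum>j<n. c i * X i j * v j) + c i * X i s * a" for c :: "nat \<Rightarrow> complex" and i
  proof -
    have "(\<Sum>j<n. c i * X i j * (v j + (if j = s then a else 0))) =
        (\<Sum>j<n. c i * X i j * v j + (if j = s then c i * X i s * a else 0))"
      by (intro sum.cong) (auto simp: algebra_simps)
    then show ?thesis using assms by (simp add: sum.distrib)
  qed
  have "form n X (\<lambda>i. v i + (if i = s then a else 0)) =
      (\<Sum>i<n. (\<Sum>j<n. cnj (v i + (if i = s then a else 0)) * X i j * v j) +
        cnj (v i + (if i = s then a else 0)) * X i s * a)"
    unfolding form_def by (rule sum.cong[OF refl]) (rule inner)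
  also have "\<dots> = (\<Sum>i<n. cnj (v i + (if i = s then a else 0)) * ((\<Sum>j<n. X i j * v j) + X i s * a))"
    by (simp only: sum_distrib_left distrib_left mult.assoc)
  also have "\<dots> = (\<Sum>i<n. cnj (v i) * ((\<Sum>j<n. X i j * v j) + X i s * a)) +
      (\<Sum>i<n. if i = s then cnj a * ((\<Sum>j<n. X i j * v j) + X i s * a) else 0)"
    unfolding sum.distrib[symmetric] by (intro sum.cong) (auto simp: algebra_simps)
  also have "(\<Sum>i<n. cnj (v i) * ((\<Sum>j<n. X i j * v j) + X i s * a)) =
      form n X v + (\<Sum>i<n. cnj (v i) * X i s) * a"
    by (simp only: form_def distrib_left sum.distrib sum_distrib_left sum_distrib_right mult.assoc)
  also have "(\<Sum>i<n. if i = s then cnj a * ((\<Sum>j<n. X i j * v j) + X i s * a) else 0) =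
      cnj a * (\<Sum>j<n. X s j * v j) + cnj a * X s s * a"
    using assms by (simp add: distrib_left)
  finally show ?thesis by (simp only: add_ac)
qed

lemma form_Suc_zero: "form (Suc n) X (v(n := 0)) = form n X v"
  by (simp add: form_def)

text \<open>Induction over the size, with a Cholesky step: subtracting the rank one matrix given by the
  last column leaves a positive matrix whose last row and column vanish.\<close>

lemma trace_product_nonneg:
  assumes "\<And>v. form n X v \<in> \<real>\<^sub>\<ge>\<^sub>0" and "\<And>v. form n Y v \<in> \<real>\<^sub>\<ge>\<^sub>0"
  shows "(\<Sum>s<n. \<Sum>t<n. X s t * Y s t) \<in> \<real>\<^sub>\<ge>\<^sub>0"
  using assms
proof (induction n arbitrary: X)
  case (Suc n)
  have Y: "form n Y v \<in> \<real>\<^sub>\<ge>\<^sub>0" for v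
    using Suc.prems(2)[of "v(n := 0)"] unfolding form_Suc_zero .
  have zero: "(\<Sum>s<Suc n. \<Sum>t<Suc n. Z s t * Y s t) \<in> \<real>\<^sub>\<ge>\<^sub>0"
    if pos: "\<And>v. form (Suc n) Z v \<in> \<real>\<^sub>\<ge>\<^sub>0" and z: "Z n n = 0" for Z
  proof -
    have col: "Z s n = 0" if "s \<le> n" for s
      using form_nonneg_zero_diag[OF pos, of s n] that z by simp
    have row: "Z n s = 0" if "s \<le> n" for s
      using form_real_imp_hermitian[of "Suc n" Z s n] subsetD[OF nonneg_Reals_subset_Reals pos]
        col[OF that] that by simp
    have "form n Z v \<in> \<real>\<^sub>\<ge>\<^sub>0" for v
      using pos[of "v(n := 0)"] unfolding form_Suc_zero .
    then have "(\<Sum>s<n. \<Sum>t<n. Z s t * Y s t) \<in> \<real>\<^sub>\<ge>\<^sub>0" using Suc.IH[OF _ Y] by blast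
    then show ?thesis using col row by simp
  qed
  define r where "r = X n n"
  have herm: "X t s = cnj (X s t)" if "s < Suc n" "t < Suc n" for s t
    by (rule form_real_imp_hermitian[OF _ that]) (use Suc.prems(1) nonneg_Reals_subset_Reals in blast)
  show ?case
  proof (cases "r = 0")
    case True
    then show ?thesis using zero[OF Suc.prems(1)] by (simp add: r_def)
  next
    case False
    define Z where "Z = (\<lambda>s t. X s t - X s n * cnj (X t n) / r)"
    have r: "r \<in> \<real>\<^sub>\<ge>\<^sub>0"
      using Suc.prems(1)[of "\<lambda>i. if i = n then 1 else 0"] by (simp add: form_one r_def)
    then have cr: "cnj r = r" by (auto simp: complex_nonneg_Reals_iff complex_eq_iff)
    have ir: "1 / r \<in> \<real>\<^sub>\<ge>\<^sub>0" using nonneg_Reals_divide_I[OF nonneg_Reals_one_I r] .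
    have "form (Suc n) Z v \<in> \<real>\<^sub>\<ge>\<^sub>0" for v
    proof -
      define c where "c = (\<Sum>j<Suc n. X n j * v j)"
      have c': "(\<Sum>i<Suc n. cnj (v i) * X i n) = cnj c"
        unfolding c_def cnj_sum by (rule sum.cong) (auto simp: herm[of n])
      \<comment> \<open>The shift by -c/r minimizes the form of X in the last coordinate, and the
        minimum is the form of Z at v. Hence Z inherits positivity from X.\<close>
      have "form (Suc n) X (\<lambda>i. v i + (if i = n then - (c / r) else 0)) =
          form (Suc n) X v - cnj c * c / r"
        unfolding form_add_single[OF lessI] c' c_def[symmetric] r_def[symmetric]
        using False by (simp add: cr field_simps)
      also have "cnj c * c / r = (\<Sum>i<Suc n. \<Sum>j<Suc n. cnj (v i) * (X i n * cnj (X j n) / r) * v j)"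
        unfolding c'[symmetric] unfolding c_def sum_product sum_divide_distrib
        by (intro sum.cong refl) (use herm[of _ n] in \<open>simp add: mult_ac\<close>)
      also have "form (Suc n) X v - \<dots> = form (Suc n) Z v"
        unfolding form_def Z_def sum_subtractf[symmetric] by (simp only: algebra_simps)
      finally show ?thesis using Suc.prems(1) by metis
    qed
    moreover have "Z n n = 0" using False by (simp add: Z_def r_def[symmetric] cr)
    ultimately have "(\<Sum>s<Suc n. \<Sum>t<Suc n. Z s t * Y s t) \<in> \<real>\<^sub>\<ge>\<^sub>0" by (rule zero)
    \<comment> \<open>The subtracted rank one part, paired with Y, is 1/r times the form of Y at the
      conjugate of the last column of X.\<close>
    moreover have "1 / r * form (Suc n) Y (\<lambda>i. cnj (X i n)) \<in> \<real>\<^sub>\<ge>\<^sub>0"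
      by (rule nonneg_Reals_mult_I[OF ir Suc.prems(2)])
    ultimately have "(\<Sum>s<Suc n. \<Sum>t<Suc n. Z s t * Y s t) + 1 / r * form (Suc n) Y (\<lambda>i. cnj (X i n)) \<in> \<real>\<^sub>\<ge>\<^sub>0"
      by (rule nonneg_Reals_add_I)
    also have "(\<Sum>s<Suc n. \<Sum>t<Suc n. Z s t * Y s t) + 1 / r * form (Suc n) Y (\<lambda>i. cnj (X i n)) =
        (\<Sum>s<Suc n. \<Sum>t<Suc n. X s t * Y s t)"
      unfolding form_def sum_distrib_left sum.distrib[symmetric]
      by (intro sum.cong refl) (simp add: Z_def algebra_simps)
    finally show ?thesis .
  qed
qed simp

section \<open>Tensors\<close>

lemma tensor_eq_base: "u - v \<in> tensor_relations \<Longrightarrow> tensor_eq u v"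
  by (simp add: tensor_eq_def complex_vector.span_base)

lemma tens_add_left: "(x + x') \<otimes>\<^sub>t y = x \<otimes>\<^sub>t y + x' \<otimes>\<^sub>t y"
  by transfer (rule tensor_eq_base, unfold tensor_relations_def, blast)

lemma tens_add_right: "x \<otimes>\<^sub>t (y + y') = x \<otimes>\<^sub>t y + x \<otimes>\<^sub>t y'"
  by transfer (rule tensor_eq_base, unfold tensor_relations_def, blast)

lemma tens_scaleC_left: "(c *\<^sub>C x) \<otimes>\<^sub>t y = c *\<^sub>C (x \<otimes>\<^sub>t y)"
  by transfer (rule tensor_eq_base, unfold tensor_relations_def, blast)

lemma tens_scaleC_right: "x \<otimes>\<^sub>t (c *\<^sub>C y) = c *\<^sub>C (x \<otimes>\<^sub>t y)"
  by transfer (rule tensor_eq_base, unfold tensor_relations_def, blast)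

lemma tens_zero_left [simp]: "0 \<otimes>\<^sub>t y = 0"
  using tens_scaleC_left[of 0 0 y] by simp

lemma tens_zero_right [simp]: "x \<otimes>\<^sub>t 0 = 0"
  using tens_scaleC_right[of x 0 0] by simp

lemma tens_diff_left: "(x - x') \<otimes>\<^sub>t y = x \<otimes>\<^sub>t y - x' \<otimes>\<^sub>t y"
  using tens_add_left[of "x - x'" x' y] by (simp add: algebra_simps)

lemma tens_diff_right: "x \<otimes>\<^sub>t (y - y') = x \<otimes>\<^sub>t y - x \<otimes>\<^sub>t y'"
  using tens_add_right[of x "y - y'" y'] by (simp add: algebra_simps)

lemma tens_sum_left: "(\<Sum>i\<in>I. f i) \<otimes>\<^sub>t y = (\<Sum>i\<in>I. f i \<otimes>\<^sub>t y)"
  by (induction I rule: infinite_finite_induct) (simp_all add: tens_add_left)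

lemma tens_sum_right: "x \<otimes>\<^sub>t (\<Sum>i\<in>I. f i) = (\<Sum>i\<in>I. x \<otimes>\<^sub>t f i)"
  by (induction I rule: infinite_finite_induct) (simp_all add: tens_add_right)

lemma tens_in_tensor_space: "x \<in> V \<Longrightarrow> y \<in> W \<Longrightarrow> x \<otimes>\<^sub>t y \<in> tensor_space V W"
  unfolding tensor_space_def by (rule complex_vector.span_base) blast

text \<open>Bilinearity moves the coefficients of the left factor into the right factor, so that
  every tensor gets the same fixed left legs \<open>s a\<close>.\<close>

lemma tensor_space_expand:
  fixes d :: nat and s :: "nat \<Rightarrow> 'a::complex_vector"
  assumes W: "complex_vector.subspace W" and V: "\<And>x. x \<in> V \<Longrightarrow> x = (\<Sum>a<d. e a x *\<^sub>C s a)"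
    and u: "u \<in> tensor_space V W"
  shows "\<exists>w. (\<forall>a<d::nat. w a \<in> W) \<and> u = (\<Sum>a<d. s a \<otimes>\<^sub>t w a)"
  using u unfolding tensor_space_def
proof (induction rule: complex_vector.span_induct_alt)
  case base
  show ?case using complex_vector.subspace_0[OF W] by (intro exI[of _ "\<lambda>_. 0"] conjI) simp_all
next
  case (step c p v)
  from step(1) obtain x y where xy: "p = x \<otimes>\<^sub>t y" "x \<in> V" "y \<in> W" by auto
  from step(2) obtain w where w: "\<forall>a<d. w a \<in> W" "v = (\<Sum>a<d. s a \<otimes>\<^sub>t w a)" by auto
  have "x \<otimes>\<^sub>t y = (\<Sum>a<d. e a x *\<^sub>C s a) \<otimes>\<^sub>t y" using V[OF xy(2)] by (rule arg_cong)
  also have "\<dots> = (\<Sum>a<d. s a \<otimes>\<^sub>t (e a x *\<^sub>C y))"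
    by (simp only: tens_sum_left tens_scaleC_left tens_scaleC_right)
  finally have "c *\<^sub>C p + v = (\<Sum>a<d. s a \<otimes>\<^sub>t (c *\<^sub>C e a x *\<^sub>C y + w a))"
    by (simp only: xy(1) w(2) tens_add_right tens_scaleC_right sum.distrib complex_vector.scale_sum_right)
  moreover have "\<forall>a<d. c *\<^sub>C e a x *\<^sub>C y + w a \<in> W"
    using w(1) xy(3) by (auto simp: complex_vector.subspace_add[OF W] complex_vector.subspace_scale[OF W])
  ultimately show ?case by (intro exI[of _ "\<lambda>a. c *\<^sub>C e a x *\<^sub>C y + w a"] conjI)
qed

section \<open>The cones of the maximal tensor product\<close>

text \<open>The product A (P \<otimes> Q) A^* of \<open>D_max\<close>, with the column index
  \<open>a * r + b\<close> of A replaced by the pair (a, b). Direct sums in P and Q can then be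
  taken separately, without index arithmetic.\<close>

definition block_conj :: "nat \<Rightarrow> nat \<Rightarrow> nat \<Rightarrow> (nat \<Rightarrow> nat \<Rightarrow> nat \<Rightarrow> complex) \<Rightarrow>
    'a::complex_vector matrix \<Rightarrow> 'b::complex_vector matrix \<Rightarrow> ('a, 'b) tensor matrix"
  where "block_conj n k r A P Q = (\<lambda>i j. if i < n \<and> j < n then
    (\<Sum>a<k. \<Sum>b<r. \<Sum>a'<k. \<Sum>b'<r. (A i a b * cnj (A j a' b')) *\<^sub>C (P a a' \<otimes>\<^sub>t Q b b')) else 0)"

lemma conjugate_kron:
  "conjugate n (k * r) A (kron k r P Q) = block_conj n k r (\<lambda>i a b. A i (a * r + b)) P Q"
  by (auto simp: conjugate_def kron_def block_conj_def sum_blocks block_index_less fun_eq_iff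
      intro!: sum.cong)

lemma D_max_block_conjE:
  assumes "U \<in> D_max S T n"
  obtains k r A P Q where "P \<in> cone (op_sys S) k" "Q \<in> cone (op_sys T) r" "U = block_conj n k r A P Q"
  using assms unfolding D_max_def by (auto simp: conjugate_kron)

lemma block_conj_in_D_max:
  assumes "P \<in> cone (op_sys S) k" "Q \<in> cone (op_sys T) r"
  shows "block_conj n k r A P Q \<in> D_max S T n"
proof -
  \<comment> \<open>The flattened coefficients, cut off to zero outside their format as membership
    in \<open>mats\<close> demands.\<close>
  define A' where "A' = (\<lambda>i p. if i < n \<and> p < k * r then A i (p div r) (p mod r) else 0)"
  have "conjugate n (k * r) A' (kron k r P Q) = block_conj n k r A P Q"
    unfolding conjugate_kron
    by (auto simp: block_conj_def A'_def block_index_less fun_eq_iff intro!: sum.cong)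
  moreover have "A' \<in> mats n (k * r) UNIV" by (auto simp: A'_def mats_def)
  ultimately show ?thesis using assms unfolding D_max_def mem_Collect_eq
    by (intro exI[of _ k] exI[of _ r] exI[of _ P] exI[of _ Q] exI[of _ A'] conjI) simp_all
qed

definition dsum :: "nat \<Rightarrow> nat \<Rightarrow> 'a::zero matrix \<Rightarrow> 'a matrix \<Rightarrow> 'a matrix"
  where "dsum k l P Q = (\<lambda>i j. if i < k \<and> j < k then P i j
    else if k \<le> i \<and> i < k + l \<and> k \<le> j \<and> j < k + l then Q (i - k) (j - k) else 0)"

lemma dsum_in_cone:
  assumes S: "complex_vector.subspace S" and P: "P \<in> cone (op_sys S) k" and Q: "Q \<in> cone (op_sys S) l"
  shows "dsum k l P Q \<in> cone (op_sys S) (k + l)"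
proof -
  have "opform (k + l) (dsum k l P Q) h = opform k P h + opform l Q (\<lambda>i. h (k + i))" for h
    by (simp add: opform_def sum_lessThan_add dsum_def zero_bop.rep_eq cong: sum.cong_simp)
  then have "opform (k + l) (dsum k l P Q) h \<in> \<real>\<^sub>\<ge>\<^sub>0" for h
    using P Q by (simp add: cone_op_sys nonneg_Reals_add_I)
  moreover have "dsum k l P Q \<in> mats (k + l) (k + l) S"
  proof (rule matsI)
    fix i j assume ij: "i < k + l" "j < k + l"
    show "dsum k l P Q i j \<in> S"
      using ij mats_in[OF cone_op_sys_mats[OF P], of i j] complex_vector.subspace_0[OF S]
        mats_in[OF cone_op_sys_mats[OF Q], of "i - k" "j - k"]
      by (cases "i < k"; cases "j < k") (simp_all add: dsum_def)
  qed (auto simp: dsum_def)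
  ultimately show ?thesis by (simp add: cone_op_sys)
qed

text \<open>The diagonal blocks of (P \<oplus> R) \<otimes> (Q \<oplus> W) are P \<otimes> Q and R
  \<otimes> W together with the unwanted P \<otimes> W and R \<otimes> Q. The coefficients
  \<open>C\<close> vanish on the unwanted ones, which leaves the two given products.\<close>

lemma D_max_add:
  assumes S: "complex_vector.subspace S" and T: "complex_vector.subspace T"
    and U: "U \<in> D_max S T n" and V: "V \<in> D_max S T n"
  shows "U + V \<in> D_max S T n"
proof -
  obtain k r A P Q where U': "P \<in> cone (op_sys S) k" "Q \<in> cone (op_sys T) r" "U = block_conj n k r A P Q"
    using U by (rule D_max_block_conjE)
  obtain l s B R W where V': "R \<in> cone (op_sys S) l" "W \<in> cone (op_sys T) s" "V = block_conj n l s B R W"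
    using V by (rule D_max_block_conjE)
  define C where "C = (\<lambda>i a b. if a < k \<and> b < r then A i a b
    else if k \<le> a \<and> r \<le> b then B i (a - k) (b - r) else 0)"
  have "U + V = block_conj n (k + l) (r + s) C (dsum k l P R) (dsum r s Q W)"
    by (simp add: U'(3) V'(3) block_conj_def fun_eq_iff sum_lessThan_add C_def dsum_def
        cong: sum.cong_simp)
  then show ?thesis
    using block_conj_in_D_max dsum_in_cone[OF S U'(1) V'(1)] dsum_in_cone[OF T U'(2) V'(2)] by metis
qed

text \<open>The separate summand \<open>U\<close> is the base of the induction, so that closure
  under addition is all that is used.\<close>

lemma D_max_sum:
  assumes S: "complex_vector.subspace S" and T: "complex_vector.subspace T"
    and "finite I" "U \<in> D_max S T n" "\<And>i. i \<in> I \<Longrightarrow> V i \<in> D_max S T n"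
  shows "U + (\<Sum>i\<in>I. V i) \<in> D_max S T n"
  using assms(3,5)
proof (induction I rule: finite_induct)
  case (insert i I)
  have "U + sum V I \<in> D_max S T n" "V i \<in> D_max S T n" using insert by blast+
  then have "V i + (U + sum V I) \<in> D_max S T n" by (rule D_max_add[OF S T, rotated])
  also have "V i + (U + sum V I) = U + sum V (insert i I)"
    unfolding sum.insert[OF insert(1,2)] by (rule add.left_commute)
  finally show ?case .
qed (simp add: assms)

text \<open>A positive element is a positive 1 x 1 matrix, and conjugation by the identity matrix
  leaves s \<otimes> Q as it is.\<close>

lemma elementary_in_D_max:
  assumes s: "s \<in> S" "\<And>h. cinner (bop_apply s h) h \<in> \<real>\<^sub>\<ge>\<^sub>0" and Q: "Q \<in> cone (op_sys T) n"
  shows "(\<lambda>i j. s \<otimes>\<^sub>t Q i j) \<in> D_max S T n"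
proof -
  define P where "P = (\<lambda>(i::nat) (j::nat). if i < 1 \<and> j < 1 then s else 0)"
  have "P \<in> mats 1 1 S"
    by (rule matsI) (use s(1) in \<open>auto simp: P_def\<close>)
  moreover have "opform 1 P h \<in> \<real>\<^sub>\<ge>\<^sub>0" for h
    using s(2) by (simp add: P_def opform_def)
  ultimately have "P \<in> cone (op_sys S) 1" by (simp add: cone_op_sys)
  then have "block_conj n 1 n (\<lambda>i a b. if i = b then 1 else 0) P Q \<in> D_max S T n"
    using Q by (rule block_conj_in_D_max)
  also have "block_conj n 1 n (\<lambda>i a b. if i = b then 1 else 0) P Q = (\<lambda>i j. s \<otimes>\<^sub>t Q i j)"
  proof (intro ext)
    fix i j
    show "block_conj n 1 n (\<lambda>i a b. if i = b then 1 else 0) P Q i j = s \<otimes>\<^sub>t Q i j"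
    proof (cases "i < n \<and> j < n")
      case True
      then have "block_conj n 1 n (\<lambda>i a b. if i = b then 1 else 0) P Q i j =
          (\<Sum>b<n. \<Sum>b'<n. ((if i = b then 1 else 0) * cnj (if j = b' then 1 else 0)) *\<^sub>C (s \<otimes>\<^sub>t Q b b'))"
        by (simp only: block_conj_def One_nat_def sum.lessThan_Suc lessThan_0 sum.empty P_def) simp
      also have "\<dots> = s \<otimes>\<^sub>t Q i j"
        by (subst sum_single[of _ i], use True in simp, use True in simp, simp,
          subst sum_single[of _ j]) (use True in \<open>auto simp: scaleC_one\<close>)
      finally show ?thesis .
    next
      case False
      then show ?thesis using mats_zero[OF cone_op_sys_mats[OF Q] False]
        by (simp only: block_conj_def if_False tens_zero_right)
    qed
  qed
  finally show ?thesis .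
qed

section \<open>Norms and quadratic forms\<close>

text \<open>Makes the supremum in \<open>mat_norm\<close> meaningful. The sum of the operator norms
  of all entries is a crude bound, but any bound will do.\<close>

lemma mat_norm_bdd:
  fixes X :: "'h::complex_hilbert bop matrix"
  shows "bdd_above ((\<lambda>h. L2_set (\<lambda>i. norm (\<Sum>j<m. bop_apply (X i j) (h j))) {..<m}) `
    {h. L2_set (\<lambda>j. norm (h j)) {..<m} \<le> 1})"
proof (rule bdd_aboveI2)
  fix h :: "nat \<Rightarrow> 'h" assume "h \<in> {h. L2_set (\<lambda>j. norm (h j)) {..<m} \<le> 1}"
  then have L: "L2_set (\<lambda>j. norm (h j)) {..<m} \<le> 1" by simp
  have h: "norm (h j) \<le> 1" if "j < m" for j
    using order_trans[OF member_le_L2_set L] that by simp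
  have o: "norm (bop_apply (X i j) (h j)) \<le> onorm (bop_apply (X i j))" if "j < m" for i j
  proof -
    have "norm (bop_apply (X i j) (h j)) \<le> onorm (bop_apply (X i j)) * norm (h j)"
      by (rule onorm[OF bounded_linear_bop])
    also have "\<dots> \<le> onorm (bop_apply (X i j)) * 1"
      using h[OF that] onorm_pos_le[OF bounded_linear_bop] by (rule mult_left_mono)
    finally show ?thesis by simp
  qed
  have "L2_set (\<lambda>i. norm (\<Sum>j<m. bop_apply (X i j) (h j))) {..<m} \<le>
      (\<Sum>i<m. norm (\<Sum>j<m. bop_apply (X i j) (h j)))"
    by (rule L2_set_le_sum) simp
  also have "\<dots> \<le> (\<Sum>i<m. \<Sum>j<m. onorm (bop_apply (X i j)))"
    by (intro sum_mono order_trans[OF norm_sum] o) simp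
  finally show "L2_set (\<lambda>i. norm (\<Sum>j<m. bop_apply (X i j) (h j))) {..<m} \<le>
    (\<Sum>i<m. \<Sum>j<m. onorm (bop_apply (X i j)))" .
qed

lemma mat_norm_upper:
  "L2_set (\<lambda>j. norm (h j)) {..<m} \<le> 1 \<Longrightarrow>
    L2_set (\<lambda>i. norm (\<Sum>j<m. bop_apply (X i j) (h j))) {..<m} \<le> mat_norm m X"
  unfolding mat_norm_def by (rule cSUP_upper[OF _ mat_norm_bdd]) simp

lemma mat_norm_nonneg: "0 \<le> mat_norm m X"
  using mat_norm_upper[of "\<lambda>_. 0" m X] by (simp add: L2_set_def)

lemma mat_norm_least:
  assumes "\<And>h. L2_set (\<lambda>j. norm (h j)) {..<m} \<le> 1 \<Longrightarrow>
    L2_set (\<lambda>i. norm (\<Sum>j<m. bop_apply (X i j) (h j))) {..<m} \<le> c"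
  shows "mat_norm m X \<le> c"
  unfolding mat_norm_def
proof (rule cSUP_least)
  show "{h::nat \<Rightarrow> 'a. L2_set (\<lambda>j. norm (h j)) {..<m} \<le> 1} \<noteq> {}"
    by (auto simp: L2_set_def intro!: exI[of _ "\<lambda>_. 0"])
qed (use assms in simp)

lemma mat_norm_apply:
  "L2_set (\<lambda>i. norm (\<Sum>j<m. bop_apply (X i j) (h j))) {..<m} \<le>
    mat_norm m X * L2_set (\<lambda>j. norm (h j)) {..<m}"
proof (cases "L2_set (\<lambda>j. norm (h j)) {..<m} = 0")
  case True
  then have "h j = 0" if "j < m" for j using that by (simp add: L2_set_eq_0_iff)
  then have "L2_set (\<lambda>i. norm (\<Sum>j<m. bop_apply (X i j) (h j))) {..<m} = L2_set (\<lambda>i. 0) {..<m}"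
    by (intro L2_set_cong) auto
  with True show ?thesis by (simp add: L2_set_def)
next
  case False
  define L where "L = L2_set (\<lambda>j. norm (h j)) {..<m}"
  have L: "L > 0" using False L2_set_nonneg unfolding L_def by (metis less_eq_real_def)
  have eq: "(\<Sum>j<m. bop_apply (X i j) ((1 / L) *\<^sub>R h j)) = (1 / L) *\<^sub>R (\<Sum>j<m. bop_apply (X i j) (h j))" for i
    unfolding scaleR_sum_right
    by (intro sum.cong refl linear_scale bounded_linear.linear bounded_linear_bop)
  have "L2_set (\<lambda>j. norm ((1 / L) *\<^sub>R h j)) {..<m} = 1"
    using L L2_set_right_distrib[of "1 / L" "\<lambda>j. norm (h j)" "{..<m}"] by (simp add: L_def[symmetric])
  then have "L2_set (\<lambda>i. norm (\<Sum>j<m. bop_apply (X i j) ((1 / L) *\<^sub>R h j))) {..<m} \<le> mat_norm m X"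
    by (intro mat_norm_upper) simp
  then have "1 / L * L2_set (\<lambda>i. norm (\<Sum>j<m. bop_apply (X i j) (h j))) {..<m} \<le> mat_norm m X"
    unfolding eq using L L2_set_right_distrib[of "1 / L" "\<lambda>i. norm (\<Sum>j<m. bop_apply (X i j) (h j))" "{..<m}"]
    by simp
  then show ?thesis using L by (simp add: L_def[symmetric] field_simps)
qed

text \<open>Cauchy-Schwarz in two stages, first in H for each coordinate and then for the lists of
  norms.\<close>

lemma cmod_opform_le:
  "cmod (opform m X h) \<le> mat_norm m X * (\<Sum>i<m. (norm (h i))\<^sup>2)"
proof -
  let ?N = "\<lambda>i. norm (\<Sum>j<m. bop_apply (X i j) (h j))"
  have "opform m X h = (\<Sum>i<m. cinner (\<Sum>j<m. bop_apply (X i j) (h j)) (h i))"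
    by (simp add: opform_def cinner_sum_left)
  then have "cmod (opform m X h) \<le> (\<Sum>i<m. \<bar>?N i\<bar> * \<bar>norm (h i)\<bar>)"
    by (auto intro!: order_trans[OF norm_sum] sum_mono cmod_cinner_le)
  also have "\<dots> \<le> L2_set ?N {..<m} * L2_set (\<lambda>j. norm (h j)) {..<m}"
    by (rule L2_set_mult_ineq)
  also have "\<dots> \<le> (mat_norm m X * L2_set (\<lambda>j. norm (h j)) {..<m}) * L2_set (\<lambda>j. norm (h j)) {..<m}"
    by (intro mult_right_mono mat_norm_apply L2_set_nonneg)
  also have "\<dots> = mat_norm m X * (\<Sum>i<m. (norm (h i))\<^sup>2)"
    by (simp add: L2_set_def sum_nonneg)
  finally show ?thesis .
qed

lemma opform_add: "opform m (\<lambda>i j. X i j + Y i j) h = opform m X h + opform m Y h"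
  by (simp add: opform_def bop_simps cinner_simps sum.distrib)

lemma opform_diff: "opform m (\<lambda>i j. X i j - Y i j) h = opform m X h - opform m Y h"
  by (simp add: opform_def bop_simps cinner_simps sum_subtractf)

lemma opform_sum_scale:
  "opform m (\<lambda>i j. \<Sum>a\<in>I. c a *\<^sub>C X a i j) h = (\<Sum>a\<in>I. c a * opform m (X a) h)"
  by (simp add: opform_def bop_simps cinner_simps sum_distrib_left sum.swap[of _ _ I])

abbreviation scalar_mat :: "nat \<Rightarrow> 'v::zero \<Rightarrow> 'v matrix"
  where "scalar_mat m x \<equiv> (\<lambda>i j. if i = j \<and> i < m then x else 0)"

lemma opform_scalar_mat:
  "opform m (scalar_mat m (of_real c *\<^sub>C 1)) h = of_real (c * (\<Sum>i<m. (norm (h i))\<^sup>2))"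
proof -
  have "(\<Sum>j<m. cinner (bop_apply (scalar_mat m (of_real c *\<^sub>C 1) i j) (h j)) (h i)) =
      of_real (c * (norm (h i))\<^sup>2)" if "i < m" for i
    by (subst sum_single[of _ i]) (use that in \<open>auto simp: bop_simps cinner_simps cinner_self\<close>)
  then show ?thesis by (simp add: opform_def sum_distrib_left)
qed

text \<open>The order unit property of the identity in M_m(T), in quantitative form: the form of the
  scalar matrix c is c times the squared length of h, which outweighs the real form of W.\<close>

lemma scalar_mat_plus_in_cone:
  assumes T: "operator_system T" and W: "W \<in> mats m m T"
    and re: "\<And>h. opform m W h \<in> \<real>" and le: "\<And>h. cmod (opform m W h) \<le> c * (\<Sum>i<m. (norm (h i))\<^sup>2)"
  shows "(\<lambda>i j. scalar_mat m (of_real c *\<^sub>C 1) i j + W i j) \<in> cone (op_sys T) m"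
  unfolding cone_op_sys
proof
  have sub: "complex_vector.subspace T" "1 \<in> T" using T by (simp_all add: operator_system_def)
  show "(\<lambda>i j. scalar_mat m (of_real c *\<^sub>C 1) i j + W i j) \<in> mats m m T"
    using sub complex_vector.subspace_0[OF sub(1)] mats_in[OF W] mats_zero[OF W]
    by (intro matsI) (auto simp: complex_vector.subspace_add complex_vector.subspace_scale)
  show "\<forall>h. opform m (\<lambda>i j. scalar_mat m (of_real c *\<^sub>C 1) i j + W i j) h \<in> \<real>\<^sub>\<ge>\<^sub>0"
  proof
    fix h
    have "\<bar>Re (opform m W h)\<bar> \<le> c * (\<Sum>i<m. (norm (h i))\<^sup>2)"
      using abs_Re_le_cmod le order_trans by blast
    moreover have "Im (opform m W h) = 0" using re[of h] by (simp add: complex_is_Real_iff)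
    ultimately show "opform m (\<lambda>i j. scalar_mat m (of_real c *\<^sub>C 1) i j + W i j) h \<in> \<real>\<^sub>\<ge>\<^sub>0"
      unfolding opform_add opform_scalar_mat by (simp add: complex_nonneg_Reals_iff)
  qed
qed

text \<open>Compresses an operator matrix to the span of r vectors \<open>g a\<close>, giving an r x
  r scalar matrix. In this way facts about positive scalar matrices are transferred to operator
  matrices.\<close>

lemma opform_compress:
  "opform n P (\<lambda>k. \<Sum>a<r. v a *\<^sub>C g a k) =
    form r (\<lambda>a b. \<Sum>k<n. \<Sum>l<n. cinner (bop_apply (P k l) (g b l)) (g a k)) v"
proof -
  have "opform n P (\<lambda>k. \<Sum>a<r. v a *\<^sub>C g a k) =
      (\<Sum>k<n. \<Sum>l<n. \<Sum>a<r. \<Sum>b<r. cnj (v a) * cinner (bop_apply (P k l) (g b l)) (g a k) * v b)"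
    unfolding opform_def
  proof (intro sum.cong refl)
    fix k l
    show "cinner (bop_apply (P k l) (\<Sum>a<r. v a *\<^sub>C g a l)) (\<Sum>a<r. v a *\<^sub>C g a k) =
        (\<Sum>a<r. \<Sum>b<r. cnj (v a) * cinner (bop_apply (P k l) (g b l)) (g a k) * v b)"
      by (simp add: bop_sum_right bop_scale_right cinner_sum_left cinner_sum_right cinner_scaleC_left
          cinner_scaleC_right sum_distrib_left mult_ac)
  qed
  also have "\<dots> = (\<Sum>a<r. \<Sum>b<r. \<Sum>k<n. \<Sum>l<n. cnj (v a) * cinner (bop_apply (P k l) (g b l)) (g a k) * v b)"
    by (simp only: sum.swap[of _ "{..<r}" "{..<n}"])
  finally show ?thesis
    by (simp only: form_def sum_distrib_left sum_distrib_right)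
qed

section \<open>Adjoints, and the entries of positive operator matrices\<close>

lemma is_adjoint_unique:
  assumes "is_adjoint B A" "is_adjoint B' A" shows "B = B'"
proof (rule bop_eqI)
  fix y
  have "cinner x (bop_apply B y - bop_apply B' y) = 0" for x
    using assms unfolding is_adjoint_def
    by (metis cinner_commute cinner_diff_left diff_self)
  then have "cinner (bop_apply B y - bop_apply B' y) x = 0" for x
    by (metis cinner_commute complex_cnj_zero)
  then show "bop_apply B y = bop_apply B' y" using cinner_eq_zeroI by fastforce
qed

lemma is_adjoint_sym: "is_adjoint B A \<Longrightarrow> is_adjoint A B"
  unfolding is_adjoint_def by (metis cinner_commute)

lemma is_adjoint_add: "is_adjoint B A \<Longrightarrow> is_adjoint B' A' \<Longrightarrow> is_adjoint (B + B') (A + A')"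
  by (simp add: is_adjoint_def bop_simps cinner_simps)

lemma is_adjoint_scaleC: "is_adjoint B A \<Longrightarrow> is_adjoint (cnj c *\<^sub>C B) (c *\<^sub>C A)"
  by (simp add: is_adjoint_def bop_simps cinner_simps)

lemma is_adjoint_sum:
  "(\<And>i. i \<in> I \<Longrightarrow> is_adjoint (B i) (A i)) \<Longrightarrow> is_adjoint (\<Sum>i\<in>I. B i) (\<Sum>i\<in>I. A i)"
  by (simp add: is_adjoint_def bop_simps cinner_simps)

lemma cinner_selfadjoint_real: "is_adjoint A A \<Longrightarrow> cinner (bop_apply A h) h \<in> \<real>"
  unfolding is_adjoint_def by (metis cinner_commute Reals_cnj_iff)

text \<open>P is compressed to two vectors, one with y in slot i and one with x in slot j. The
  resulting 2 x 2 scalar matrix is Hermitian, and its off-diagonal entries express the adjoint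
  relation; the slots may coincide.\<close>

lemma cone_op_sys_adjoint:
  fixes S :: "'h::complex_hilbert bop set"
  assumes P: "P \<in> cone (op_sys S) n" and i: "i < n" and j: "j < n"
  shows "is_adjoint (P j i) (P i j)"
  unfolding is_adjoint_def
proof (intro allI)
  fix x y :: 'h
  define q where "q = (\<lambda>a::nat. if a = 0 then i else j)"
  define z where "z = (\<lambda>a::nat. if a = 0 then y else x)"
  define g where "g = (\<lambda>a (k::nat). if k = q a then z a else 0)"
  define Y where "Y = (\<lambda>a b. \<Sum>k<n. \<Sum>l<n. cinner (bop_apply (P k l) (g b l)) (g a k))"
  have qn: "q a < n" for a using i j by (simp add: q_def)
  have Y: "Y a b = cinner (bop_apply (P (q a) (q b)) (z b)) (z a)" for a b
    unfolding Y_def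
    by (subst sum_single[of _ "q a"], simp, simp add: qn, simp add: g_def,
      subst sum_single[of _ "q b"]) (simp_all add: g_def qn)
  have "form 2 Y v \<in> \<real>" for v
  proof -
    have "opform n P (\<lambda>k. \<Sum>a<2. v a *\<^sub>C g a k) \<in> \<real>\<^sub>\<ge>\<^sub>0" using P by (simp add: cone_op_sys)
    then have "form 2 Y v \<in> \<real>\<^sub>\<ge>\<^sub>0" unfolding opform_compress Y_def .
    then show ?thesis by (rule subsetD[OF nonneg_Reals_subset_Reals])
  qed
  then have "Y 1 0 = cnj (Y 0 1)" by (rule form_real_imp_hermitian) simp_all
  then show "cinner (bop_apply (P i j) x) y = cinner x (bop_apply (P j i) y)"
    by (simp add: Y q_def z_def) (metis cinner_commute complex_cnj_cnj)
qed

section \<open>Self-adjoint bases\<close>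

lemma clinear_onD:
  assumes "clinear_on V f"
  shows "x \<in> V \<Longrightarrow> y \<in> V \<Longrightarrow> f (x + y) = f x + f y" "x \<in> V \<Longrightarrow> f (c *\<^sub>C x) = c *\<^sub>C f x"
  using assms by (auto simp: clinear_on_def)

lemma clinear_on_zero:
  assumes "complex_vector.subspace V" "clinear_on V f" shows "f 0 = 0"
proof -
  have "f (0 *\<^sub>C 0) = 0 *\<^sub>C f 0"
    using assms(2) complex_vector.subspace_0[OF assms(1)] by (rule clinear_onD)
  then show ?thesis by simp
qed

lemma clinear_on_sum:
  assumes V: "complex_vector.subspace V" and f: "clinear_on V f" and x: "\<And>i. i \<in> I \<Longrightarrow> x i \<in> V"
  shows "f (\<Sum>i\<in>I. c i *\<^sub>C x i) = (\<Sum>i\<in>I. c i *\<^sub>C f (x i))"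
  using x
proof (induction I rule: infinite_finite_induct)
  case (insert i I)
  have "(\<Sum>i\<in>I. c i *\<^sub>C x i) \<in> V"
    using insert by (intro complex_vector.subspace_sum[OF V] complex_vector.subspace_scale[OF V]) auto
  moreover have "c i *\<^sub>C x i \<in> V" using insert by (simp add: complex_vector.subspace_scale[OF V])
  ultimately show ?case using insert by (simp add: clinear_onD[OF f])
qed (simp_all add: clinear_on_zero[OF V f])

lemma dualD: "f \<in> dual V \<Longrightarrow> clinear_on V f" "f \<in> dual V \<Longrightarrow> x \<notin> V \<Longrightarrow> f x = 0"
  by (simp_all add: dual_def)

lemma subspace_dual: "complex_vector.subspace (dual V)"
  by (rule complex_vector.subspaceI)
    (auto simp: dual_def clinear_on_def scaleC_fun_def scaleC_complex_def algebra_simps)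

text \<open>The coordinate functionals \<open>e\<close> are carried along with the self-adjoint
  basis \<open>s\<close> because they serve twice: as a basis of the dual, and as the functionals at
  which slices are read off.\<close>

definition sa_basis :: "'h::complex_hilbert bop set \<Rightarrow> nat \<Rightarrow> (nat \<Rightarrow> 'h bop) \<Rightarrow>
    (nat \<Rightarrow> 'h bop \<Rightarrow> complex) \<Rightarrow> bool"
  where "sa_basis S d s e \<longleftrightarrow>
    (\<forall>a<d. s a \<in> S \<and> is_adjoint (s a) (s a) \<and> e a \<in> dual S) \<and>
    (\<forall>x\<in>S. x = (\<Sum>a<d. e a x *\<^sub>C s a)) \<and>
    (\<forall>a<d. \<forall>b<d. e a (s b) = (if a = b then 1 else 0))"

text \<open>A maximal independent set of self-adjoint elements spans S: if y is the adjoint of x,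
  then x = (1/2) (x + y) + (-\<i>/2) \<i> (x - y), where x + y and \<i> (x - y) are
  self-adjoint.\<close>

lemma ex_sa_basis:
  assumes S: "operator_system S" and fin: "fin_dim S"
  obtains d s e where "sa_basis S d s e"
proof -
  have sub: "complex_vector.subspace S" using S by (simp add: operator_system_def)
  define G where "G = {x \<in> S. is_adjoint x x}"
  obtain B where B: "B \<subseteq> G" "complex_vector.independent B" "G \<subseteq> complex_vector.span B"
    using complex_vector.maximal_independent_subset by blast
  have "x \<in> complex_vector.span B" if x: "x \<in> S" for x
  proof -
    obtain y where y: "y \<in> S" "is_adjoint y x" using S x by (auto simp: operator_system_def)
    have "x + y \<in> G"
      using x y is_adjoint_add[OF y(2) is_adjoint_sym[OF y(2)]]
      by (simp add: G_def complex_vector.subspace_add[OF sub] add.commute)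
    moreover have "\<i> *\<^sub>C (x + (-1) *\<^sub>C y) \<in> G"
    proof -
      have "is_adjoint (cnj \<i> *\<^sub>C (y + cnj (-1) *\<^sub>C x)) (\<i> *\<^sub>C (x + (-1) *\<^sub>C y))"
        by (intro is_adjoint_scaleC is_adjoint_add y is_adjoint_sym[OF y(2)])
      moreover have "cnj \<i> *\<^sub>C (y + cnj (-1) *\<^sub>C x) = \<i> *\<^sub>C (x + (-1) *\<^sub>C y)"
        by (simp add: scaleC_add_right scaleC_scaleC add.commute complex_vector.scale_right_diff_distrib)
      ultimately show ?thesis using x y
        by (simp add: G_def complex_vector.subspace_diff[OF sub] complex_vector.subspace_scale[OF sub])
    qed
    ultimately have "x + y \<in> complex_vector.span B" "\<i> *\<^sub>C (x + (-1) *\<^sub>C y) \<in> complex_vector.span B"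
      using B(3) by blast+
    then have "(1/2) *\<^sub>C (x + y) + (- \<i> / 2) *\<^sub>C \<i> *\<^sub>C (x + (-1) *\<^sub>C y) \<in> complex_vector.span B"
      by (rule complex_vector.span_add[OF complex_vector.span_scale complex_vector.span_scale])
    also have "(1/2) *\<^sub>C (x + y) + (- \<i> / 2) *\<^sub>C \<i> *\<^sub>C (x + (-1) *\<^sub>C y) =
        (1/2 + 1/2) *\<^sub>C x + (1/2 + (-1/2)) *\<^sub>C y"
      by (simp only: scaleC_add_right scaleC_add_left scaleC_scaleC) (simp add: add_ac)
    also have "\<dots> = x" by (simp add: scaleC_one)
    finally show ?thesis .
  qed
  moreover have BS: "B \<subseteq> S" using B(1) by (auto simp: G_def)
  then have "complex_vector.span B \<subseteq> S" by (rule complex_vector.span_minimal[OF _ sub])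
  ultimately have span: "complex_vector.span B = S" by blast
  obtain F where "finite F" "S = complex_vector.span F" using fin by (auto simp: fin_dim_def)
  then have "finite B"
    using complex_vector.independent_span_bound[of F B] B(2) BS by simp
  then obtain s where s: "bij_betw s {..<card B} B"
    using ex_bij_betw_nat_finite[of B] by (auto simp: lessThan_atLeast0)
  define e where "e = (\<lambda>a x. complex_vector.representation B x (s a))"
  have sB: "s a \<in> B" if "a < card B" for a using s that by (auto simp: bij_betw_def)
  \<comment> \<open>\<open>representation\<close> is zero outside the span, which agrees with the
    convention of \<open>dual\<close> that functionals vanish off the subspace.\<close>
  have "complex_vector.representation B x b = 0" if "x \<notin> S" for x b
    using that by (simp add: complex_vector.representation_def span)
  then have "e a \<in> dual S" for a
    unfolding dual_def clinear_on_def e_def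
    using B(2) by (auto simp: span complex_vector.representation_add complex_vector.representation_scale
        scaleC_complex_def)
  moreover have "x = (\<Sum>a<card B. e a x *\<^sub>C s a)" if "x \<in> S" for x
  proof -
    have "x = (\<Sum>b\<in>B. complex_vector.representation B x b *\<^sub>C b)"
      using complex_vector.sum_representation_eq[OF B(2), of x B] that \<open>finite B\<close> by (simp add: span)
    also have "\<dots> = (\<Sum>a<card B. e a x *\<^sub>C s a)"
      unfolding e_def by (rule sum.reindex_bij_betw[OF s, symmetric])
    finally show ?thesis .
  qed
  moreover have "e a (s b) = (if a = b then 1 else 0)" if "a < card B" "b < card B" for a b
    using complex_vector.representation_basis[OF B(2) sB[OF that(2)]] that s
    by (auto simp: e_def bij_betw_def inj_on_def)
  moreover have "s a \<in> S \<and> is_adjoint (s a) (s a)" if "a < card B" for a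
    using sB[OF that] B(1) unfolding G_def by blast
  ultimately have "sa_basis S (card B) s e"
    unfolding sa_basis_def by blast
  then show thesis by (rule that)
qed

text \<open>Taking adjoints in the expansion of x conjugates the coefficients and keeps the basis,
  so coordinate functionals are Hermitian.\<close>

lemma sa_basis_coord_adjoint:
  assumes sub: "complex_vector.subspace S" and b: "sa_basis S d s e"
    and xy: "x \<in> S" "y \<in> S" "is_adjoint y x" and a: "a < d"
  shows "e a y = cnj (e a x)"
proof -
  have x: "x = (\<Sum>a<d. e a x *\<^sub>C s a)" using b xy(1) by (simp add: sa_basis_def)
  have "is_adjoint (\<Sum>a<d. cnj (e a x) *\<^sub>C s a) (\<Sum>a<d. e a x *\<^sub>C s a)"
    using b by (intro is_adjoint_sum is_adjoint_scaleC) (simp add: sa_basis_def)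
  then have "y = (\<Sum>a<d. cnj (e a x) *\<^sub>C s a)"
    unfolding x[symmetric] by (rule is_adjoint_unique[OF xy(3)])
  then have "e a y = e a (\<Sum>b<d. cnj (e b x) *\<^sub>C s b)" by simp
  also have "\<dots> = (\<Sum>b<d. cnj (e b x) *\<^sub>C e a (s b))"
    using b a by (intro clinear_on_sum[OF sub]) (auto simp: sa_basis_def dest: dualD)
  also have "\<dots> = cnj (e a x)"
    by (subst sum_single[of _ a]) (use a b in \<open>auto simp: sa_basis_def scaleC_complex_def\<close>)
  finally show ?thesis .
qed

section \<open>Slices\<close>

text \<open>One family \<open>w\<close> serves all functionals at once; this replaces the
  description operator in \<open>slice\<close> by an explicit formula.\<close>

lemma slice_expand:
  assumes S: "complex_vector.subspace S" and T: "complex_vector.subspace T"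
    and b: "sa_basis S d s e" and u: "u \<in> tensor_space S T"
  obtains w where "\<And>a. a < d \<Longrightarrow> w a \<in> T" "u = (\<Sum>a<d. s a \<otimes>\<^sub>t w a)"
    "\<And>f. f \<in> dual S \<Longrightarrow> slice S T u f = (\<Sum>a<d. f (s a) *\<^sub>C w a)"
proof -
  have "\<And>x. x \<in> S \<Longrightarrow> x = (\<Sum>a<d. e a x *\<^sub>C s a)" using b by (simp only: sa_basis_def)
  from tensor_space_expand[OF T this u]
  obtain w where w: "\<forall>a<d. w a \<in> T" "u = (\<Sum>a<d. s a \<otimes>\<^sub>t w a)" by blast
  moreover have "slice S T u f = (\<Sum>a<d. f (s a) *\<^sub>C w a)" if "f \<in> dual S" for f
    unfolding w(2) using b w(1) by (intro slice_sum_tens[OF S that]) (simp add: sa_basis_def)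
  ultimately show thesis using that by blast
qed

lemma slice_add:
  assumes S: "complex_vector.subspace S" and T: "complex_vector.subspace T"
    and b: "sa_basis S d s e" and u: "u \<in> tensor_space S T" and v: "v \<in> tensor_space S T"
    and f: "f \<in> dual S"
  shows "slice S T (u + v) f = slice S T u f + slice S T v f"
proof -
  obtain w where w: "\<And>a. a < d \<Longrightarrow> w a \<in> T" "u = (\<Sum>a<d. s a \<otimes>\<^sub>t w a)"
    "\<And>f. f \<in> dual S \<Longrightarrow> slice S T u f = (\<Sum>a<d. f (s a) *\<^sub>C w a)"
    using slice_expand[OF S T b u] by metis
  obtain z where z: "\<And>a. a < d \<Longrightarrow> z a \<in> T" "v = (\<Sum>a<d. s a \<otimes>\<^sub>t z a)"
    "\<And>f. f \<in> dual S \<Longrightarrow> slice S T v f = (\<Sum>a<d. f (s a) *\<^sub>C z a)"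
    using slice_expand[OF S T b v] by metis
  have "u + v = (\<Sum>a<d. s a \<otimes>\<^sub>t (w a + z a))"
    by (simp only: w(2) z(2) tens_add_right sum.distrib)
  moreover have "slice S T (\<Sum>a<d. s a \<otimes>\<^sub>t (w a + z a)) f = (\<Sum>a<d. f (s a) *\<^sub>C (w a + z a))"
    using b w(1) z(1) complex_vector.subspace_add[OF T]
    by (intro slice_sum_tens[OF S f]) (simp add: sa_basis_def)
  ultimately show ?thesis
    by (simp only: w(3)[OF f] z(3)[OF f] scaleC_add_right sum.distrib)
qed

lemma slice_zero:
  assumes "complex_vector.subspace S" "f \<in> dual S" shows "slice S T 0 f = 0"
  using slice_sum_tens[OF assms, of 0 "\<lambda>_. 0" "\<lambda>_. 0" T] by simp

lemma slice_tens:
  assumes "complex_vector.subspace S" "f \<in> dual S" "x \<in> S" "y \<in> T"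
  shows "slice S T (x \<otimes>\<^sub>t y) f = f x *\<^sub>C y"
  using slice_sum_tens[OF assms(1,2), of 1 "\<lambda>_. x" "\<lambda>_. y" T] assms(3,4) by simp

lemma subspace_tensor_space: "complex_vector.subspace (tensor_space S T)"
  by (simp add: tensor_space_def complex_vector.subspace_span)

lemma slice_sum:
  assumes S: "complex_vector.subspace S" and T: "complex_vector.subspace T"
    and b: "sa_basis S d s e" and f: "f \<in> dual S" and u: "\<And>i. i \<in> I \<Longrightarrow> u i \<in> tensor_space S T"
  shows "slice S T (\<Sum>i\<in>I. u i) f = (\<Sum>i\<in>I. slice S T (u i) f)"
  using u
proof (induction I rule: infinite_finite_induct)
  case (insert i I)
  then have "slice S T (u i + sum u I) f = slice S T (u i) f + slice S T (sum u I) f"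
    by (intro slice_add[OF S T b _ _ f] complex_vector.subspace_sum[OF subspace_tensor_space]) auto
  with insert show ?case by simp
qed (simp_all add: slice_zero[OF S f])

text \<open>The dual basis picks out the right legs one by one, so a tensor is determined by its
  map. This is how an approximation of the map becomes an approximation of the tensor.\<close>

lemma tensor_eq_sum_slice:
  assumes S: "complex_vector.subspace S" and T: "complex_vector.subspace T"
    and b: "sa_basis S d s e" and u: "u \<in> tensor_space S T"
  shows "u = (\<Sum>a<d. s a \<otimes>\<^sub>t slice S T u (e a))"
proof -
  obtain w where w: "\<And>a. a < d \<Longrightarrow> w a \<in> T" "u = (\<Sum>a<d. s a \<otimes>\<^sub>t w a)"
    "\<And>f. f \<in> dual S \<Longrightarrow> slice S T u f = (\<Sum>a<d. f (s a) *\<^sub>C w a)"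
    using slice_expand[OF S T b u] by metis
  have "slice S T u (e a) = w a" if "a < d" for a
  proof -
    have "slice S T u (e a) = (\<Sum>b<d. e a (s b) *\<^sub>C w b)"
      using b that by (intro w(3)) (simp add: sa_basis_def)
    also have "\<dots> = w a"
      by (subst sum_single[of _ a]) (use that b in \<open>auto simp: sa_basis_def scaleC_one\<close>)
    finally show ?thesis .
  qed
  then have "(\<Sum>a<d. s a \<otimes>\<^sub>t w a) = (\<Sum>a<d. s a \<otimes>\<^sub>t slice S T u (e a))" by simp
  with w(2) show ?thesis by (rule trans)
qed

section \<open>The order unit of the maximal tensor product\<close>

lemma sum_mat_apply: "(\<Sum>a\<in>I. V a) i j = (\<Sum>a\<in>I. V a i j :: 'v::comm_monoid_add)"
  by (induction I rule: infinite_finite_induct) simp_all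

lemma scalar_plus_selfadjoint_nonneg:
  assumes re: "cinner (bop_apply A h) h \<in> \<real>" and c: "onorm (bop_apply A) \<le> c"
  shows "cinner (bop_apply (of_real c *\<^sub>C 1 + A) h) h \<in> \<real>\<^sub>\<ge>\<^sub>0"
    and "cinner (bop_apply (of_real c *\<^sub>C 1 - A) h) h \<in> \<real>\<^sub>\<ge>\<^sub>0"
proof -
  have "cmod (cinner (bop_apply A h) h) \<le> norm (bop_apply A h) * norm h" by (rule cmod_cinner_le)
  also have "\<dots> \<le> onorm (bop_apply A) * norm h * norm h"
    by (intro mult_right_mono onorm[OF bounded_linear_bop]) simp
  also have "\<dots> \<le> c * norm h * norm h" by (intro mult_right_mono c) simp_all
  finally have "\<bar>Re (cinner (bop_apply A h) h)\<bar> \<le> c * (norm h)\<^sup>2"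
    using abs_Re_le_cmod[of "cinner (bop_apply A h) h"] by (simp add: power2_eq_square mult.assoc)
  moreover have "Im (cinner (bop_apply A h) h) = 0" using re by (simp add: complex_is_Real_iff)
  ultimately show "cinner (bop_apply (of_real c *\<^sub>C 1 + A) h) h \<in> \<real>\<^sub>\<ge>\<^sub>0"
    "cinner (bop_apply (of_real c *\<^sub>C 1 - A) h) h \<in> \<real>\<^sub>\<ge>\<^sub>0"
    by (simp_all add: bop_simps cinner_simps cinner_self complex_nonneg_Reals_iff flip: of_real_power)
qed

text \<open>With $c$ bounding the norms of the $s_a$ and $\delta$ those of the $w_a$, use
  $s \otimes w + c\delta = \frac12 ((c + s) \otimes (\delta + w) + (c - s) \otimes (\delta - w))$.\<close>

lemma small_perturbation_in_D_max:
  fixes S :: "'h::complex_hilbert bop set" and T :: "'k::complex_hilbert bop set" and d m :: nat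
  assumes S: "operator_system S" and T: "operator_system T" and \<epsilon>: "\<epsilon> > 0"
    and sa: "\<forall>a<d. s a \<in> S \<and> is_adjoint (s a) (s a)"
  shows "\<exists>\<delta>>0. \<forall>w. (\<forall>a<d. w a \<in> mats m m T \<and> (\<forall>h. opform m (w a) h \<in> \<real>) \<and>
      mat_norm m (w a) \<le> \<delta>) \<longrightarrow>
      (\<lambda>i j. scalar_mat m (of_real \<epsilon> *\<^sub>C (1 \<otimes>\<^sub>t 1)) i j + (\<Sum>a<d. s a \<otimes>\<^sub>t w a i j)) \<in> D_max S T m"
proof -
  note s = sa[rule_format]
  have sub: "complex_vector.subspace S" "1 \<in> S" using S by (simp_all add: operator_system_def)
  have subT: "complex_vector.subspace T" "1 \<in> T" using T by (simp_all add: operator_system_def)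
  \<comment> \<open>The summand 1 keeps c positive even if all \<open>s a\<close> vanish; \<delta>
    is a quotient by c.\<close>
  define c where "c = 1 + (\<Sum>a<d. onorm (bop_apply (s a)))"
  have on: "onorm (bop_apply (s a)) \<ge> 0" for a by (rule onorm_pos_le[OF bounded_linear_bop])
  have c: "c > 0" using sum_nonneg[of "{..<d}" "\<lambda>a. onorm (bop_apply (s a))"] on by (simp add: c_def)
  have sc: "onorm (bop_apply (s a)) \<le> c" if "a < d" for a
    using member_le_sum[of a "{..<d}" "\<lambda>a. onorm (bop_apply (s a))"] on that by (simp add: c_def)
  \<comment> \<open>Each of the d indices uses up c \<delta> = \<eta> times the unit, and one
    further share \<eta> goes into \<open>E\<close>, the summand from which \<open>D_max_sum\<close>
    starts. The shares add up to \<epsilon>, also for d = 0.\<close>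
  define \<eta> where "\<eta> = \<epsilon> / (real d + 1)"
  define \<delta> where "\<delta> = \<eta> / c"
  have \<eta>: "\<eta> > 0" using \<epsilon> by (simp add: \<eta>_def)
  have \<delta>: "\<delta> > 0" using \<eta> c by (simp add: \<delta>_def)
  have cd: "c * \<delta> = \<eta>" using c by (simp add: \<delta>_def)
  show ?thesis
  proof (intro exI[of _ \<delta>] conjI \<delta> allI impI)
    fix w assume w: "\<forall>a<d. w a \<in> mats m m T \<and> (\<forall>h. opform m (w a) h \<in> \<real>) \<and> mat_norm m (w a) \<le> \<delta>"
    have wT: "w a \<in> mats m m T" and wr: "opform m (w a) h \<in> \<real>" and wn: "mat_norm m (w a) \<le> \<delta>"
      if "a < d" for a h
      using w that by blast+
    define R where "R = (\<lambda>a. of_real c *\<^sub>C 1 + s a)"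
    define R' where "R' = (\<lambda>a. of_real c *\<^sub>C 1 - s a)"
    define Q where "Q = (\<lambda>a i j. scalar_mat m (of_real \<delta> *\<^sub>C 1) i j + w a i j)"
    define Q' where "Q' = (\<lambda>a i j. scalar_mat m (of_real \<delta> *\<^sub>C 1) i j + (- w a i j))"
    have RS: "R a \<in> S" "R' a \<in> S" if "a < d" for a
      using s[OF that] sub
      by (simp_all add: R_def R'_def complex_vector.subspace_add complex_vector.subspace_diff
          complex_vector.subspace_scale)
    have Rp: "cinner (bop_apply (R a) h) h \<in> \<real>\<^sub>\<ge>\<^sub>0" "cinner (bop_apply (R' a) h) h \<in> \<real>\<^sub>\<ge>\<^sub>0"
      if "a < d" for a h
      unfolding R_def R'_def using s[OF that] sc[OF that]
      by (simp_all add: scalar_plus_selfadjoint_nonneg cinner_selfadjoint_real)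
    have half: "cinner (bop_apply ((1/2) *\<^sub>C A) h) h \<in> \<real>\<^sub>\<ge>\<^sub>0"
      if "cinner (bop_apply A h) h \<in> \<real>\<^sub>\<ge>\<^sub>0" for A :: "'h bop" and h
      using that by (simp add: bop_simps cinner_simps complex_nonneg_Reals_iff)
    have le: "cmod (opform m (w a) h) \<le> \<delta> * (\<Sum>i<m. (norm (h i))\<^sup>2)" if "a < d" for a h
      by (rule order_trans[OF cmod_opform_le]) (intro mult_right_mono wn that sum_nonneg, simp)
    have neg: "opform m (\<lambda>i j. - w a i j) h = - opform m (w a) h" for a h
      using opform_diff[of m "\<lambda>i j. 0" "w a" h] by (simp add: opform_def bop_simps)
    have Q: "Q a \<in> cone (op_sys T) m" if "a < d" for a
      unfolding Q_def by (rule scalar_mat_plus_in_cone[OF T wT wr le]) (rule that)+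
    have Q': "Q' a \<in> cone (op_sys T) m" if "a < d" for a
      unfolding Q'_def
    proof (rule scalar_mat_plus_in_cone[OF T])
      show "(\<lambda>i j. - w a i j) \<in> mats m m T"
        using mats_in[OF wT[OF that]] mats_zero[OF wT[OF that]]
        by (intro matsI) (auto simp: complex_vector.subspace_neg[OF subT(1)])
      show "opform m (\<lambda>i j. - w a i j) h \<in> \<real>" for h
        unfolding neg using wr[OF that] by simp
      show "cmod (opform m (\<lambda>i j. - w a i j) h) \<le> \<delta> * (\<Sum>i<m. (norm (h i))\<^sup>2)" for h
        unfolding neg norm_minus_cancel by (rule le[OF that])
    qed
    define E where "E = (\<lambda>i j. (of_real \<eta> *\<^sub>C 1 :: 'h bop) \<otimes>\<^sub>t scalar_mat m (of_real 1 *\<^sub>C 1 :: 'k bop) i j)"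
    have "E \<in> D_max S T m"
      unfolding E_def
    proof (rule elementary_in_D_max)
      show "of_real \<eta> *\<^sub>C 1 \<in> S" using sub by (simp add: complex_vector.subspace_scale)
      show "cinner (bop_apply (of_real \<eta> *\<^sub>C 1) h) h \<in> \<real>\<^sub>\<ge>\<^sub>0" for h :: 'h
        using \<eta> by (simp add: bop_simps cinner_simps cinner_self complex_nonneg_Reals_iff flip: of_real_power)
      have "scalar_mat m (of_real 1 *\<^sub>C 1 :: 'k bop) \<in> mats m m T"
        using subT by (intro matsI) (auto simp: complex_vector.subspace_0 scaleC_one)
      then show "scalar_mat m (of_real 1 *\<^sub>C 1 :: 'k bop) \<in> cone (op_sys T) m"
        unfolding cone_op_sys opform_scalar_mat nonneg_Reals_of_real_iff by (simp add: sum_nonneg)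
    qed
    define V where "V = (\<lambda>a i j. ((1/2) *\<^sub>C R a) \<otimes>\<^sub>t Q a i j)"
    define V' where "V' = (\<lambda>a i j. ((1/2) *\<^sub>C R' a) \<otimes>\<^sub>t Q' a i j)"
    have "V a + V' a \<in> D_max S T m" if "a < d" for a
      unfolding V_def V'_def
      by (intro D_max_add[OF sub(1) subT(1)] elementary_in_D_max half Rp Q Q' RS that
          complex_vector.subspace_scale[OF sub(1)])
    then have "E + (\<Sum>a<d. V a + V' a) \<in> D_max S T m"
      by (intro D_max_sum[OF sub(1) subT(1)] \<open>E \<in> D_max S T m\<close>) auto
    also have "E + (\<Sum>a<d. V a + V' a) =
        (\<lambda>i j. scalar_mat m (of_real \<epsilon> *\<^sub>C (1 \<otimes>\<^sub>t 1)) i j + (\<Sum>a<d. s a \<otimes>\<^sub>t w a i j))"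
    proof (intro ext)
      fix i j
      have VV: "V a i j + V' a i j = scalar_mat m (of_real \<eta> *\<^sub>C (1 \<otimes>\<^sub>t 1)) i j + s a \<otimes>\<^sub>t w a i j" for a
      proof -
        let ?I = "scalar_mat m (1::'k bop) i j"
        have Qs: "Q a i j = of_real \<delta> *\<^sub>C ?I + w a i j" "Q' a i j = of_real \<delta> *\<^sub>C ?I - w a i j"
          by (auto simp: Q_def Q'_def)
        have half: "(1/2) *\<^sub>C x + (1/2) *\<^sub>C x = x" for x :: "('h bop, 'k bop) tensor"
          by (simp add: scaleC_one flip: scaleC_add_left)
        have "V a i j + V' a i j =
            ((1/2) *\<^sub>C of_real \<eta> *\<^sub>C (1 \<otimes>\<^sub>t ?I) + (1/2) *\<^sub>C of_real \<eta> *\<^sub>C (1 \<otimes>\<^sub>t ?I)) +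
            ((1/2) *\<^sub>C (s a \<otimes>\<^sub>t w a i j) + (1/2) *\<^sub>C (s a \<otimes>\<^sub>t w a i j))"
          by (simp add: V_def V'_def Qs R_def R'_def tens_scaleC_left tens_scaleC_right tens_add_left
            tens_add_right tens_diff_left tens_diff_right cd[symmetric] scaleC_add_right
            complex_vector.scale_right_diff_distrib scaleC_scaleC mult_ac)
        then show ?thesis unfolding half by auto
      qed
      have EE: "E i j = scalar_mat m (of_real \<eta> *\<^sub>C (1 \<otimes>\<^sub>t 1)) i j"
        by (simp add: E_def tens_scaleC_left scaleC_one)
      have EV: "scalar_mat m (of_real \<eta> *\<^sub>C (1 \<otimes>\<^sub>t 1 :: ('h bop, 'k bop) tensor)) i j +
          (\<Sum>a<d. scalar_mat m (of_real \<eta> *\<^sub>C (1 \<otimes>\<^sub>t 1)) i j) =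
          scalar_mat m (of_real \<epsilon> *\<^sub>C (1 \<otimes>\<^sub>t 1)) i (j::nat)"
      proof -
        have *: "z + (\<Sum>a<n. z) = of_nat (n + 1) *\<^sub>C z" for z :: "('h bop, 'k bop) tensor" and n :: nat
        proof -
          have "(\<Sum>a<n. z) = of_nat n *\<^sub>C z"
          proof (induction n)
            case (Suc n)
            have "of_nat (Suc n) *\<^sub>C z = z + of_nat n *\<^sub>C z"
              unfolding of_nat_Suc scaleC_add_left scaleC_one by (rule refl)
            then show ?case unfolding sum.lessThan_Suc Suc.IH by (simp only: add.commute)
          qed simp
          then show ?thesis
            unfolding of_nat_add of_nat_1 scaleC_add_left scaleC_one by (simp only: add.commute)
        qed
        have dd: "of_nat (d + 1) * complex_of_real \<eta> = of_real \<epsilon>"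
        proof -
          have "(real d + 1) * \<eta> = \<epsilon>" by (simp add: \<eta>_def)
          then have "complex_of_real ((real d + 1) * \<eta>) = of_real \<epsilon>" by (rule arg_cong)
          then show ?thesis by (simp add: add.commute)
        qed
        show ?thesis
        proof (cases "i = j \<and> i < m")
          case True
          show ?thesis unfolding * if_P[OF True] scaleC_scaleC dd ..
        qed auto
      qed
      have "(E + (\<Sum>a<d. V a + V' a)) i j = E i j + (\<Sum>a<d. V a i j + V' a i j)"
        by (simp only: plus_fun_apply sum_mat_apply)
      also have "\<dots> = (scalar_mat m (of_real \<eta> *\<^sub>C (1 \<otimes>\<^sub>t 1)) i j +
          (\<Sum>a<d. scalar_mat m (of_real \<eta> *\<^sub>C (1 \<otimes>\<^sub>t 1)) i j)) + (\<Sum>a<d. s a \<otimes>\<^sub>t w a i j)"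
        unfolding VV EE by (simp only: sum.distrib add.assoc)
      finally show "(E + (\<Sum>a<d. V a + V' a)) i j =
          scalar_mat m (of_real \<epsilon> *\<^sub>C (1 \<otimes>\<^sub>t 1)) i j + (\<Sum>a<d. s a \<otimes>\<^sub>t w a i j)"
        unfolding EV .
    qed
    finally show "(\<lambda>i j. scalar_mat m (of_real \<epsilon> *\<^sub>C (1 \<otimes>\<^sub>t 1)) i j + (\<Sum>a<d. s a \<otimes>\<^sub>t w a i j)) \<in> D_max S T m" .
  qed
qed

section \<open>From factorizations to decompositions\<close>

lemma completely_positiveD:
  assumes "completely_positive V W f"
  shows "clinear_on (vecs V) f" "x \<in> vecs V \<Longrightarrow> f x \<in> vecs W"
    "X \<in> cone V k \<Longrightarrow> (\<lambda>i j. f (X i j)) \<in> cone W k"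
  using assms by (auto simp: completely_positive_def)

text \<open>On S this is f applied to the expansion in the basis \<open>s\<close>; off S both sides
  vanish by the convention of \<open>dual\<close>.\<close>

lemma dual_expand:
  assumes S: "complex_vector.subspace S" and b: "sa_basis S d s e" and f: "f \<in> dual S"
  shows "f = (\<Sum>a<d. f (s a) *\<^sub>C e a)"
proof
  fix x
  have ap: "(\<Sum>a<d. f (s a) *\<^sub>C e a) x = (\<Sum>a<d. f (s a) * e a x)"
    by (induction d) (simp_all add: scaleC_fun_def scaleC_complex_def)
  show "f x = (\<Sum>a<d. f (s a) *\<^sub>C e a) x"
  proof (cases "x \<in> S")
    case True
    then have "f x = f (\<Sum>a<d. e a x *\<^sub>C s a)" using b by (simp add: sa_basis_def)
    also have "\<dots> = (\<Sum>a<d. e a x *\<^sub>C f (s a))"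
      using b by (intro clinear_on_sum[OF S dualD(1)[OF f]]) (simp add: sa_basis_def)
    finally show ?thesis unfolding ap by (simp add: scaleC_complex_def mult.commute)
  next
    case False
    moreover have "e a x = 0" if "a < d" for a
      using b that False by (auto simp: sa_basis_def dest: dualD)
    ultimately show ?thesis unfolding ap using dualD(2)[OF f] by simp
  qed
qed

text \<open>Positivity of the matrix representing \<open>\<phi>\<close> is tested on the positive elements
  $[x \mapsto \langle x h_l, h_k\rangle]_{kl}$ of $M_n(S^d)$.\<close>

lemma cp_on_dual_representing_matrix:
  fixes S :: "'h::complex_hilbert bop set"
  assumes S: "operator_system S" and b: "sa_basis S d s e"
    and \<phi>: "completely_positive (dual_sys (op_sys S)) (mat_alg n) \<phi>"
    and p: "p = (\<lambda>i j. \<Sum>a<d. \<phi> (e a) i j *\<^sub>C s a)"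
  shows "p \<in> cone (op_sys S) n" and "\<And>f. f \<in> dual S \<Longrightarrow> \<phi> f = (\<lambda>i j. f (p i j))"
proof -
  have sub: "complex_vector.subspace S" using S by (simp add: operator_system_def)
  have ed: "e a \<in> dual S" and sS: "s a \<in> S" if "a < d" for a
    using b that by (simp_all add: sa_basis_def)
  show eq: "\<phi> f = (\<lambda>i j. f (p i j))" if f: "f \<in> dual S" for f
  proof -
    have "\<phi> f = \<phi> (\<Sum>a<d. f (s a) *\<^sub>C e a)" using dual_expand[OF sub b f] by (rule arg_cong)
    also have "\<dots> = (\<Sum>a<d. f (s a) *\<^sub>C \<phi> (e a))"
      using completely_positiveD(1)[OF \<phi>] ed by (intro clinear_on_sum[OF subspace_dual]) simp_all
    also have "\<dots> = (\<lambda>i j. f (p i j))"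
    proof (intro ext)
      fix i j
      have "f (p i j) = (\<Sum>a<d. \<phi> (e a) i j *\<^sub>C f (s a))"
        unfolding p by (rule clinear_on_sum[OF sub dualD(1)[OF f]]) (simp add: sS)
      then show "(\<Sum>a<d. f (s a) *\<^sub>C \<phi> (e a)) i j = f (p i j)"
        by (simp add: sum_mat_apply scaleC_fun_def scaleC_complex_def mult.commute)
    qed
    finally show ?thesis .
  qed
  have pS: "p i j \<in> S" for i j
    unfolding p by (intro complex_vector.subspace_sum[OF sub] complex_vector.subspace_scale[OF sub] sS) simp
  have "p \<in> mats n n S"
  proof (rule matsI)
    fix i j assume "\<not> (i < n \<and> j < n)"
    then have "\<phi> (e a) i j = 0" if "a < d" for a
      using completely_positiveD(2)[OF \<phi>, of "e a"] ed[OF that] mats_zero by fastforce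
    then show "p i j = 0" by (simp add: p)
  qed (rule pS)
  moreover have "opform n p h \<in> \<real>\<^sub>\<ge>\<^sub>0" for h
  proof -
    \<comment> \<open>The vector functionals are cut off to zero outside S, as \<open>dual\<close>
      demands, and outside the n x n format, as \<open>mats\<close> does.\<close>
    define F where "F = (\<lambda>k l x. if k < n \<and> l < n \<and> x \<in> S then cinner (bop_apply x (h l)) (h k) else 0)"
    have Fd: "F k l \<in> dual S" for k l
      using complex_vector.subspace_add[OF sub] complex_vector.subspace_scale[OF sub]
      by (auto simp: dual_def clinear_on_def F_def bop_simps cinner_simps scaleC_complex_def)
    have Fm: "F \<in> mats n n (dual S)"
      by (rule matsI, rule Fd) (auto simp: F_def fun_eq_iff)
    have "completely_positive (op_sys S) (mat_alg n) (\<lambda>x i j. F i j x)"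
      unfolding completely_positive_def
    proof (intro conjI allI ballI)
      show "clinear_on (vecs (op_sys S)) (\<lambda>x i j. F i j x)"
        using clinear_onD[OF dualD(1)[OF Fd]]
        by (auto simp: clinear_on_def fun_eq_iff scaleC_fun_def)
      show "(\<lambda>x i j. F i j x) ` vecs (op_sys S) \<subseteq> vecs (mat_alg n)"
        by (intro image_subsetI, unfold vecs_mat_over, rule matsI) (auto simp: F_def)
      fix k X assume X: "X \<in> cone (op_sys S) k"
      show "(\<lambda>i j a b. F a b (X i j)) \<in> cone (mat_alg n) k"
        unfolding cone_mat_alg
      proof (intro conjI allI)
        have "F a b 0 = 0" for a b by (simp add: F_def bop_simps)
        then show "(\<lambda>i j a b. F a b (X i j)) \<in> mats k k (mats n n UNIV)"
          using mats_zero[OF cone_op_sys_mats[OF X]]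
          by (intro matsI) (auto simp: fun_eq_iff, auto simp: F_def)
        fix v
        have "(\<Sum>i<k. \<Sum>a<n. \<Sum>j<k. \<Sum>b<n. cnj (v i a) * F a b (X i j) * v j b) =
            (\<Sum>i<k. \<Sum>a<n. \<Sum>j<k. \<Sum>b<n. cnj (v i a) * cinner (bop_apply (X i j) (h b)) (h a) * v j b)"
          using mats_in[OF cone_op_sys_mats[OF X]] by (intro sum.cong refl) (simp add: F_def)
        also have "\<dots> = (\<Sum>i<k. \<Sum>j<k. \<Sum>a<n. \<Sum>b<n. cnj (v i a) * cinner (bop_apply (X i j) (h b)) (h a) * v j b)"
          by (rule sum.cong[OF refl], rule sum.swap)
        \<comment> \<open>Testing the amplified map at v amounts to testing X at the vectors
          \<Sum>_a v_ia h_a.\<close>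
        also have "\<dots> = opform k X (\<lambda>i. \<Sum>a<n. v i a *\<^sub>C h a)"
          unfolding opform_def
          by (intro sum.cong refl) (simp add: bop_sum_right bop_scale_right cinner_sum_left
              cinner_sum_right cinner_scaleC_left cinner_scaleC_right sum_distrib_left mult_ac)
        also have "\<dots> \<in> \<real>\<^sub>\<ge>\<^sub>0" using X by (simp add: cone_op_sys)
        finally show "(\<Sum>i<k. \<Sum>a<n. \<Sum>j<k. \<Sum>b<n. cnj (v i a) * F a b (X i j) * v j b) \<in> \<real>\<^sub>\<ge>\<^sub>0" .
      qed
    qed
    then have "F \<in> cone (dual_sys (op_sys S)) n" using Fm by (simp add: dual_sys_def)
    then have "(\<lambda>i j. \<phi> (F i j)) \<in> cone (mat_alg n) n" by (rule completely_positiveD(3)[OF \<phi>])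
    \<comment> \<open>The test vector is the identity matrix written as a vector. It selects
      \<phi>(F_ij)_ij = F_ij(p_ij) from the blocks, and these numbers add up to <p h, h>.\<close>
    then have "(\<Sum>i<n. \<Sum>a<n. \<Sum>j<n. \<Sum>b<n. cnj (if a = i then 1 else 0) * \<phi> (F i j) a b *
        (if b = j then 1 else 0)) \<in> \<real>\<^sub>\<ge>\<^sub>0"
      unfolding cone_mat_alg by (elim conjE allE[of _ "\<lambda>i a. if a = i then 1 else 0"])
    also have "(\<Sum>i<n. \<Sum>a<n. \<Sum>j<n. \<Sum>b<n. cnj (if a = i then 1 else 0) * \<phi> (F i j) a b *
        (if b = j then 1 else 0)) = (\<Sum>i<n. \<Sum>j<n. \<phi> (F i j) i j)"
    proof (rule sum.cong[OF refl])
      fix i assume i: "i \<in> {..<n}"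
      show "(\<Sum>a<n. \<Sum>j<n. \<Sum>b<n. cnj (if a = i then 1 else 0) * \<phi> (F i j) a b *
        (if b = j then 1 else 0)) = (\<Sum>j<n. \<phi> (F i j) i j)"
        by (subst sum_single[of _ i], simp, rule i, simp, rule sum.cong[OF refl],
          subst sum_single[of _ j for j], simp, assumption) auto
    qed
    also have "\<dots> = opform n p h"
      unfolding opform_def by (intro sum.cong refl) (simp add: eq[OF Fd], simp add: F_def pS)
    finally show ?thesis .
  qed
  ultimately show "p \<in> cone (op_sys S) n" by (simp add: cone_op_sys)
qed

lemma subspace_mats:
  assumes "complex_vector.subspace V" shows "complex_vector.subspace (mats n k V)"
proof (rule complex_vector.subspaceI)
  show "0 \<in> mats n k V"
    using complex_vector.subspace_0[OF assms] by (intro matsI) simp_all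
  fix X Y c assume X: "X \<in> mats n k V" and Y: "Y \<in> mats n k V"
  show "X + Y \<in> mats n k V"
    using mats_zero[OF X] mats_zero[OF Y]
    by (intro matsI) (auto intro!: complex_vector.subspace_add[OF assms] mats_in[OF X] mats_in[OF Y])
  show "c *\<^sub>C X \<in> mats n k V"
    using mats_zero[OF X] unfolding scaleC_fun_def
    by (intro matsI) (auto intro!: complex_vector.subspace_scale[OF assms] mats_in[OF X])
qed

section \<open>Matrix units and Choi matrices\<close>

definition matrix_unit :: "nat \<Rightarrow> nat \<Rightarrow> nat \<Rightarrow> complex matrix"
  where "matrix_unit n i j = (\<lambda>a b. if i < n \<and> j < n \<and> a = i \<and> b = j then 1 else 0)"

lemma matrix_unit_in: "matrix_unit n i j \<in> mats n n UNIV"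
  by (rule matsI) (auto simp: matrix_unit_def)

text \<open>The block matrix of all matrix units has rank one: its form at v is the squared modulus
  of \<Sum>_i v_ii. Its image under a completely positive map is the Choi matrix of that
  map.\<close>

lemma matrix_units_positive: "matrix_unit n \<in> cone (mat_alg n) n"
  unfolding cone_mat_alg
proof (intro conjI allI)
  show "matrix_unit n \<in> mats n n (mats n n UNIV)"
    by (rule matsI, rule matrix_unit_in) (auto simp: matrix_unit_def fun_eq_iff)
  fix v :: "nat \<Rightarrow> nat \<Rightarrow> complex"
  have "(\<Sum>i<n. \<Sum>a<n. \<Sum>j<n. \<Sum>b<n. cnj (v i a) * matrix_unit n i j a b * v j b) =
      (\<Sum>i<n. \<Sum>j<n. cnj (v i i) * v j j)"
  proof (rule sum.cong[OF refl])
    fix i assume i: "i \<in> {..<n}"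
    show "(\<Sum>a<n. \<Sum>j<n. \<Sum>b<n. cnj (v i a) * matrix_unit n i j a b * v j b) =
        (\<Sum>j<n. cnj (v i i) * v j j)"
      by (subst sum_single[of _ i], simp, rule i, simp add: matrix_unit_def, rule sum.cong[OF refl],
        subst sum_single[of _ j for j], simp, assumption) (use i in \<open>auto simp: matrix_unit_def\<close>)
  qed
  also have "\<dots> = cnj (\<Sum>i<n. v i i) * (\<Sum>i<n. v i i)"
    by (simp only: sum_product cnj_sum)
  also have "\<dots> = of_real ((cmod (\<Sum>i<n. v i i))\<^sup>2)"
    by (simp only: complex_norm_square mult.commute)
  finally show "(\<Sum>i<n. \<Sum>a<n. \<Sum>j<n. \<Sum>b<n. cnj (v i a) * matrix_unit n i j a b * v j b) \<in> \<real>\<^sub>\<ge>\<^sub>0"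
    by (simp only: nonneg_Reals_of_real_iff zero_le_power2)
qed

lemma matrix_expand:
  assumes "M \<in> mats n n UNIV"
  shows "M = (\<Sum>(i,j)\<in>{..<n} \<times> {..<n}. M i j *\<^sub>C matrix_unit n i j)"
proof (intro ext)
  fix a b
  have "(\<Sum>(i,j)\<in>{..<n} \<times> {..<n}. M i j *\<^sub>C matrix_unit n i j) a b =
      (\<Sum>p\<in>{..<n} \<times> {..<n}. M (fst p) (snd p) * matrix_unit n (fst p) (snd p) a b)"
    by (simp add: sum_mat_apply scaleC_fun_def scaleC_complex_def case_prod_unfold)
  also have "\<dots> = M a b"
  proof (cases "a < n \<and> b < n")
    case True
    then show ?thesis
      by (subst sum_single[of _ "(a, b)"]) (auto simp: matrix_unit_def)
  next
    case False
    then show ?thesis using mats_zero[OF assms False]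
      by (auto intro!: sum.neutral simp: matrix_unit_def)
  qed
  finally show "M a b = (\<Sum>(i,j)\<in>{..<n} \<times> {..<n}. M i j *\<^sub>C matrix_unit n i j) a b" ..
qed

text \<open>Conjugation exchanges the two indices, which leaves the double sum unchanged.\<close>

lemma hermitian_trace_real:
  fixes X Y :: "complex matrix"
  assumes "\<And>i j. i < n \<Longrightarrow> j < n \<Longrightarrow> X j i = cnj (X i j)" "\<And>i j. i < n \<Longrightarrow> j < n \<Longrightarrow> Y j i = cnj (Y i j)"
  shows "(\<Sum>i<n. \<Sum>j<n. X i j * Y i j) \<in> \<real>"
proof -
  have "cnj (\<Sum>i<n. \<Sum>j<n. X i j * Y i j) = (\<Sum>i<n. \<Sum>j<n. X j i * Y j i)"
    unfolding cnj_sum complex_cnj_mult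
    by (intro sum.cong refl arg_cong2[of _ _ _ _ "(*)"] assms[symmetric]) simp_all
  also have "\<dots> = (\<Sum>i<n. \<Sum>j<n. X i j * Y i j)" by (rule sum.swap)
  finally show ?thesis by (simp add: Reals_cnj_iff)
qed

text \<open>With X the Choi matrix of \<psi> and p the matrix representing \<phi>, the element in
  question is \<Sum>_ij p_ij \<otimes> X_ij, a conjugate of p \<otimes> X. The other two claims say
  that its slices at the \<open>e c\<close> are matrices over T with real forms, as the perturbation
  argument requires.\<close>

lemma factorization_in_D_max:
  fixes S :: "'h::complex_hilbert bop set" and T :: "'k::complex_hilbert bop set"
  assumes S: "operator_system S" and b: "sa_basis S d s e"
    and \<phi>: "completely_positive (dual_sys (op_sys S)) (mat_alg n) \<phi>"
    and \<psi>: "completely_positive (mat_alg n) (mat_over m (op_sys T)) \<psi>"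
  shows "(\<lambda>i j. \<Sum>c<d. s c \<otimes>\<^sub>t \<psi> (\<phi> (e c)) i j) \<in> D_max S T m"
    and "\<And>c. c < d \<Longrightarrow> \<psi> (\<phi> (e c)) \<in> mats m m T"
    and "\<And>c h. c < d \<Longrightarrow> opform m (\<psi> (\<phi> (e c))) h \<in> \<real>"
proof -
  have sub: "complex_vector.subspace S" using S by (simp add: operator_system_def)
  have ed: "e a \<in> dual S" and sS: "s a \<in> S" if "a < d" for a
    using b that by (simp_all add: sa_basis_def)
  define p where "p = (\<lambda>i j. \<Sum>a<d. \<phi> (e a) i j *\<^sub>C s a)"
  note p = cp_on_dual_representing_matrix[OF S b \<phi> p_def]
  define X where "X = (\<lambda>i j. \<psi> (matrix_unit n i j))"
  have X: "X \<in> cone (mat_over m (op_sys T)) n"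
    unfolding X_def by (rule completely_positiveD(3)[OF \<psi> matrix_units_positive])
  then have Xm: "X \<in> mats n n (mats m m T)" by (simp add: cone_mat_over_op_sys)
  have \<phi>m: "\<phi> (e c) \<in> mats n n UNIV" if "c < d" for c
    using completely_positiveD(2)[OF \<phi>, of "e c"] ed[OF that] by simp
  show w: "\<psi> (\<phi> (e c)) \<in> mats m m T" if "c < d" for c
    using completely_positiveD(2)[OF \<psi>, of "\<phi> (e c)"] \<phi>m[OF that] by simp
  have \<psi>\<phi>: "\<psi> (\<phi> (e c)) k l = (\<Sum>i<n. \<Sum>j<n. \<phi> (e c) i j *\<^sub>C X i j k l)" if "c < d" for c k l
  proof -
    have "\<psi> (\<phi> (e c)) = \<psi> (\<Sum>(i,j)\<in>{..<n} \<times> {..<n}. \<phi> (e c) i j *\<^sub>C matrix_unit n i j)"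
      using matrix_expand[OF \<phi>m[OF that]] by (rule arg_cong)
    also have "\<dots> = (\<Sum>(i,j)\<in>{..<n} \<times> {..<n}. \<phi> (e c) i j *\<^sub>C X i j)"
      unfolding case_prod_unfold X_def
      by (rule clinear_on_sum[OF subspace_mats[OF complex_vector.subspace_UNIV] _ matrix_unit_in])
        (use completely_positiveD(1)[OF \<psi>] in simp)
    finally show ?thesis
      by (simp add: sum_mat_apply scaleC_fun_def case_prod_unfold sum.cartesian_product)
  qed
  show "opform m (\<psi> (\<phi> (e c))) h \<in> \<real>" if c: "c < d" for c h
  proof -
    \<comment> \<open>The form of \<psi>(\<phi>(e_c)) at h is the pairing \<Sum> \<phi>(e_c)_ij Y_ij
      of two Hermitian matrices: the first since p has adjoint entries and e_c respects adjoints,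
      the second since Y is X tested at the vectors v_i h_a.\<close>
    define Y where "Y = (\<lambda>i j. opform m (X i j) h)"
    have eq: "\<phi> (e c) i j = e c (p i j)" for i j by (simp add: p(2)[OF ed[OF c]])
    have "opform m (\<psi> (\<phi> (e c))) h = opform m (\<lambda>k l. \<Sum>q\<in>{..<n} \<times> {..<n}.
        \<phi> (e c) (fst q) (snd q) *\<^sub>C X (fst q) (snd q) k l) h"
      by (simp add: \<psi>\<phi>[OF c] opform_def sum.cartesian_product case_prod_unfold)
    also have "\<dots> = (\<Sum>i<n. \<Sum>j<n. \<phi> (e c) i j * Y i j)"
      unfolding opform_sum_scale[of m _ "\<lambda>q. X (fst q) (snd q)"] Y_def
      by (simp add: sum.cartesian_product case_prod_unfold)
    also have "\<dots> \<in> \<real>"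
    proof (rule hermitian_trace_real)
      fix i j assume ij: "i < n" "j < n"
      show "\<phi> (e c) j i = cnj (\<phi> (e c) i j)"
        unfolding eq using mats_in[OF cone_op_sys_mats[OF p(1)]] ij
        by (intro sa_basis_coord_adjoint[OF sub b _ _ cone_op_sys_adjoint[OF p(1) ij] c]) auto
      have "form n Y v \<in> \<real>" for v
      proof -
        have "form n Y v = (\<Sum>i<n. \<Sum>j<n. \<Sum>a<m. \<Sum>b<m.
            cinner (bop_apply (X i j a b) (v j *\<^sub>C h b)) (v i *\<^sub>C h a))"
          unfolding form_def Y_def opform_def
          by (intro sum.cong refl) (simp add: bop_scale_right cinner_scaleC_left cinner_scaleC_right
              sum_distrib_left sum_distrib_right mult_ac)
        also have "\<dots> = (\<Sum>i<n. \<Sum>a<m. \<Sum>j<n. \<Sum>b<m.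
            cinner (bop_apply (X i j a b) (v j *\<^sub>C h b)) (v i *\<^sub>C h a))"
          by (rule sum.cong[OF refl], rule sum.swap)
        also have "\<dots> \<in> \<real>\<^sub>\<ge>\<^sub>0"
          using X unfolding cone_mat_over_op_sys by (elim conjE allE[of _ "\<lambda>i a. v i *\<^sub>C h a"])
        finally show ?thesis by (rule subsetD[OF nonneg_Reals_subset_Reals])
      qed
      then show "Y j i = cnj (Y i j)" using ij by (rule form_real_imp_hermitian)
    qed
    finally show ?thesis .
  qed
  \<comment> \<open>Row i has a 1 at every pair (a, a * m + i). This couples the index of p to the
    block index of the Choi matrix, so that only p_aa' \<otimes> X_aa' survives.\<close>
  define A where "A = (\<lambda>i a b. if b = a * m + i then 1 else 0 :: complex)"
  have "unblock n m X \<in> cone (op_sys T) (n * m)" using X by (simp add: mat_over_def)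
  then have "block_conj m n (n * m) A p (unblock n m X) \<in> D_max S T m"
    by (rule block_conj_in_D_max[OF p(1)])
  also have "block_conj m n (n * m) A p (unblock n m X) = (\<lambda>i j. \<Sum>c<d. s c \<otimes>\<^sub>t \<psi> (\<phi> (e c)) i j)"
  proof (intro ext)
    fix i j
    show "block_conj m n (n * m) A p (unblock n m X) i j = (\<Sum>c<d. s c \<otimes>\<^sub>t \<psi> (\<phi> (e c)) i j)"
    proof (cases "i < m \<and> j < m")
      case True
      then have "block_conj m n (n * m) A p (unblock n m X) i j =
          (\<Sum>a<n. \<Sum>b<n * m. \<Sum>a'<n. \<Sum>b'<n * m.
            (A i a b * cnj (A j a' b')) *\<^sub>C (p a a' \<otimes>\<^sub>t unblock n m X b b'))"
        by (simp add: block_conj_def)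
      also have "\<dots> = (\<Sum>a<n. \<Sum>a'<n. p a a' \<otimes>\<^sub>t X a a' i j)"
      proof (rule sum.cong[OF refl])
        fix a assume a: "a \<in> {..<n}"
        have "(\<Sum>b<n * m. \<Sum>a'<n. \<Sum>b'<n * m. (A i a b * cnj (A j a' b')) *\<^sub>C (p a a' \<otimes>\<^sub>t unblock n m X b b'))
            = (\<Sum>a'<n. \<Sum>b'<n * m. (A i a (a * m + i) * cnj (A j a' b')) *\<^sub>C
                (p a a' \<otimes>\<^sub>t unblock n m X (a * m + i) b'))"
          by (rule sum_single) (use a True in \<open>auto simp: A_def block_index_less\<close>)
        also have "\<dots> = (\<Sum>a'<n. p a a' \<otimes>\<^sub>t X a a' i j)"
        proof (rule sum.cong[OF refl])
          fix a' assume a': "a' \<in> {..<n}"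
          have "(\<Sum>b'<n * m. (A i a (a * m + i) * cnj (A j a' b')) *\<^sub>C
                (p a a' \<otimes>\<^sub>t unblock n m X (a * m + i) b')) =
              (A i a (a * m + i) * cnj (A j a' (a' * m + j))) *\<^sub>C
                (p a a' \<otimes>\<^sub>t unblock n m X (a * m + i) (a' * m + j))"
            by (rule sum_single) (use a' True in \<open>auto simp: A_def block_index_less\<close>)
          then show "(\<Sum>b'<n * m. (A i a (a * m + i) * cnj (A j a' b')) *\<^sub>C
                (p a a' \<otimes>\<^sub>t unblock n m X (a * m + i) b')) = p a a' \<otimes>\<^sub>t X a a' i j"
            using a a' True by (simp add: A_def unblock_index scaleC_one)
        qed
        finally show "(\<Sum>b<n * m. \<Sum>a'<n. \<Sum>b'<n * m. (A i a b * cnj (A j a' b')) *\<^sub>C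
            (p a a' \<otimes>\<^sub>t unblock n m X b b')) = (\<Sum>a'<n. p a a' \<otimes>\<^sub>t X a a' i j)" .
      qed
      also have "\<dots> = (\<Sum>a<n. \<Sum>a'<n. \<Sum>c<d. s c \<otimes>\<^sub>t (\<phi> (e c) a a' *\<^sub>C X a a' i j))"
        by (simp only: p_def tens_sum_left tens_scaleC_left tens_scaleC_right)
      also have "\<dots> = (\<Sum>c<d. \<Sum>a<n. \<Sum>a'<n. s c \<otimes>\<^sub>t (\<phi> (e c) a a' *\<^sub>C X a a' i j))"
        by (simp only: sum.swap[of _ "{..<d}" "{..<n}"])
      also have "\<dots> = (\<Sum>c<d. s c \<otimes>\<^sub>t \<psi> (\<phi> (e c)) i j)"
        by (intro sum.cong refl) (simp add: \<psi>\<phi> tens_sum_right)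
      finally show ?thesis .
    next
      case False
      have "\<psi> (\<phi> (e c)) i j = 0" if "c < d" for c by (rule mats_zero[OF w[OF that] False])
      then show ?thesis using False by (simp only: block_conj_def if_False) simp
    qed
  qed
  finally show "(\<lambda>i j. \<Sum>c<d. s c \<otimes>\<^sub>t \<psi> (\<phi> (e c)) i j) \<in> D_max S T m" .
qed

section \<open>From decompositions to factorizations\<close>

text \<open>Positivity of F in the dual means complete positivity of the map it defines on S, and
  this map is applied to P. The result differs from the claim only by an exchange of the roles of
  blocks and entries, that is, by two exchanges of sums.\<close>

lemma cp_evaluate_positive_matrix:
  assumes S: "complex_vector.subspace S" and P: "P \<in> cone (op_sys S) k"
  shows "completely_positive (dual_sys (op_sys S)) (mat_alg k) (\<lambda>f i j. f (P i j))"
  unfolding completely_positive_def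
proof (intro conjI allI ballI)
  have P0: "P i j = 0" if "\<not> (i < k \<and> j < k)" for i j
    using cone_op_sys_mats[OF P] that by (rule mats_zero)
  have f0: "f 0 = 0" if "f \<in> dual S" for f
    using that by (intro clinear_on_zero[OF S] dualD(1))
  have in_mats: "(\<lambda>i j. f (P i j)) \<in> mats k k UNIV" if "f \<in> dual S" for f
    by (rule matsI) (simp_all add: P0 f0[OF that])
  show "clinear_on (vecs (dual_sys (op_sys S))) (\<lambda>f i j. f (P i j))"
    by (simp add: clinear_on_def fun_eq_iff scaleC_fun_def)
  show "(\<lambda>f i j. f (P i j)) ` vecs (dual_sys (op_sys S)) \<subseteq> vecs (mat_alg k)"
    by (intro image_subsetI) (simp add: in_mats)
  fix p F assume F: "F \<in> cone (dual_sys (op_sys S)) p"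
  then have Fm: "F \<in> mats p p (dual S)"
    and cp: "completely_positive (op_sys S) (mat_alg p) (\<lambda>x i j. F i j x)"
    by (simp_all add: dual_sys_def)
  show "(\<lambda>a b i j. F a b (P i j)) \<in> cone (mat_alg k) p"
    unfolding cone_mat_alg
  proof (intro conjI allI)
    show "(\<lambda>a b i j. F a b (P i j)) \<in> mats p p (mats k k UNIV)"
    proof (rule matsI)
      fix a b assume "a < p" "b < p"
      then have "F a b \<in> dual S" by (rule mats_in[OF Fm])
      then show "(\<lambda>i j. F a b (P i j)) \<in> mats k k UNIV" by (rule in_mats)
    next
      fix a b assume "\<not> (a < p \<and> b < p)"
      then have "F a b = 0" by (rule mats_zero[OF Fm])
      then show "(\<lambda>i j. F a b (P i j)) = 0" by (simp add: fun_eq_iff)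
    qed
    fix v
    have "(\<Sum>a<p. \<Sum>i<k. \<Sum>b<p. \<Sum>j<k. cnj (v a i) * F a b (P i j) * v b j) =
        (\<Sum>i<k. \<Sum>a<p. \<Sum>b<p. \<Sum>j<k. cnj (v a i) * F a b (P i j) * v b j)"
      by (rule sum.swap)
    also have "\<dots> = (\<Sum>i<k. \<Sum>a<p. \<Sum>j<k. \<Sum>b<p. cnj (v a i) * F a b (P i j) * v b j)"
      by (rule sum.cong[OF refl], rule sum.cong[OF refl], rule sum.swap)
    also have "\<dots> \<in> \<real>\<^sub>\<ge>\<^sub>0"
      using completely_positiveD(3)[OF cp P] unfolding cone_mat_alg
      by (elim conjE allE[of _ "\<lambda>i a. v a i"])
    finally show "(\<Sum>a<p. \<Sum>i<k. \<Sum>b<p. \<Sum>j<k. cnj (v a i) * F a b (P i j) * v b j) \<in> \<real>\<^sub>\<ge>\<^sub>0" .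
  qed
qed

text \<open>The map \<open>X -> A (X \<otimes> Q) A^*\<close>, with the index pairs of
  \<open>block_conj\<close>; in place of X \<otimes> Q the scalar entries of X multiply the vectors
  of Q.\<close>

definition kron_compression :: "nat \<Rightarrow> nat \<Rightarrow> nat \<Rightarrow> (nat \<Rightarrow> nat \<Rightarrow> nat \<Rightarrow> complex) \<Rightarrow>
    'v::complex_vector matrix \<Rightarrow> complex matrix \<Rightarrow> 'v matrix"
  where "kron_compression m k r A Q X = (\<lambda>i j. if i < m \<and> j < m then
    (\<Sum>a<k. \<Sum>b<r. \<Sum>a'<k. \<Sum>b'<r. (A i a b * cnj (A j a' b') * X a a') *\<^sub>C Q b b') else 0)"

text \<open>The form of the amplified image of X at h is \<Sum> X_st Y_st, where Y is the
  compression of Q to the components of A^* h. Both are positive scalar matrices of size p * k, so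
  \<open>trace_product_nonneg\<close> applies.\<close>

lemma cp_kron_compression:
  fixes T :: "'h::complex_hilbert bop set"
  assumes T: "complex_vector.subspace T" and Q: "Q \<in> cone (op_sys T) r"
  shows "completely_positive (mat_alg k) (mat_over m (op_sys T)) (kron_compression m k r A Q)"
  unfolding completely_positive_def
proof (intro conjI allI ballI)
  let ?\<psi> = "kron_compression m k r A Q"
  have QT: "Q b b' \<in> T" if "b < r" "b' < r" for b b'
    using cone_op_sys_mats[OF Q] that by (rule mats_in)
  have \<psi>T: "?\<psi> X \<in> mats m m T" for X
    by (rule matsI) (auto simp: kron_compression_def
        intro!: complex_vector.subspace_sum[OF T] complex_vector.subspace_scale[OF T] QT)
  have \<psi>0: "?\<psi> (\<lambda>i j. 0) = 0"
    by (simp add: kron_compression_def fun_eq_iff)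
  show "clinear_on (vecs (mat_alg k)) ?\<psi>"
    unfolding clinear_on_def
  proof (intro conjI ballI allI ext)
    fix X Y i j
    show "?\<psi> (X + Y) i j = (?\<psi> X + ?\<psi> Y) i j"
      by (simp add: kron_compression_def distrib_left scaleC_add_left sum.distrib)
    fix c
    show "?\<psi> (c *\<^sub>C X) i j = (c *\<^sub>C ?\<psi> X) i j"
      by (simp add: kron_compression_def scaleC_fun_def scaleC_complex_def
          complex_vector.scale_sum_right scaleC_scaleC mult_ac)
  qed
  show "?\<psi> ` vecs (mat_alg k) \<subseteq> vecs (mat_over m (op_sys T))"
    using \<psi>T by auto
  fix p X assume X: "X \<in> cone (mat_alg k) p"
  then have Xm: "X \<in> mats p p (mats k k UNIV)" by (simp add: cone_mat_alg)
  show "(\<lambda>i j. ?\<psi> (X i j)) \<in> cone (mat_over m (op_sys T)) p"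
    unfolding cone_mat_over_op_sys
  proof (intro conjI allI)
    show "(\<lambda>i j. ?\<psi> (X i j)) \<in> mats p p (mats m m T)"
    proof (rule matsI)
      fix i j assume "\<not> (i < p \<and> j < p)"
      then have "X i j = (\<lambda>i j. 0)" using mats_zero[OF Xm] by (auto simp: fun_eq_iff)
      then show "?\<psi> (X i j) = 0" using \<psi>0 by simp
    qed (rule \<psi>T)
    fix h :: "nat \<Rightarrow> nat \<Rightarrow> 'h"
    \<comment> \<open>The component of A^* h_i at the index pair (a, b).\<close>
    define g where "g = (\<lambda>i a b. \<Sum>x<m. cnj (A x a b) *\<^sub>C h i x)"
    define Y where "Y = (\<lambda>s t. \<Sum>b<r. \<Sum>b'<r. cinner (bop_apply (Q b b') (g (t div k) (t mod k) b')) (g (s div k) (s mod k) b))"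
    have "form (p * k) (unblock p k X) v \<in> \<real>\<^sub>\<ge>\<^sub>0" for v
      using X by (simp add: mat_over_def scalars_def form_def)
    moreover have "form (p * k) Y v \<in> \<real>\<^sub>\<ge>\<^sub>0" for v
      unfolding Y_def opform_compress[where n = r and P = Q and r = "p * k" and
          g = "\<lambda>s. g (s div k) (s mod k)", symmetric]
      using Q by (simp add: cone_op_sys)
    ultimately have "(\<Sum>s<p * k. \<Sum>t<p * k. unblock p k X s t * Y s t) \<in> \<real>\<^sub>\<ge>\<^sub>0"
      by (rule trace_product_nonneg)
    also have "(\<Sum>s<p * k. \<Sum>t<p * k. unblock p k X s t * Y s t) =
        (\<Sum>i<p. \<Sum>a<k. \<Sum>j<p. \<Sum>a'<k. X i j a a' *
          (\<Sum>b<r. \<Sum>b'<r. cinner (bop_apply (Q b b') (g j a' b')) (g i a b)))"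
      unfolding sum_blocks Y_def
      by (intro sum.cong[OF refl] arg_cong2[of _ _ _ _ "(*)"]) (simp_all add: unblock_index)
    also have "\<dots> = (\<Sum>i<p. \<Sum>a<k. \<Sum>j<p. \<Sum>a'<k. \<Sum>b<r. \<Sum>b'<r. \<Sum>x<m. \<Sum>y<m.
        A x a b * cnj (A y a' b') * X i j a a' * cinner (bop_apply (Q b b') (h j y)) (h i x))"
    proof -
      have "cinner (bop_apply (Q b b') (g j a' b')) (g i a b) =
          (\<Sum>x<m. \<Sum>y<m. A x a b * cnj (A y a' b') * cinner (bop_apply (Q b b') (h j y)) (h i x))"
        for i j a a' b b'
        unfolding g_def
        by (simp add: bop_sum_right bop_scale_right cinner_sum_left cinner_sum_right cinner_scaleC_left
          cinner_scaleC_right sum_distrib_left mult_ac)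
      then show ?thesis by (simp add: sum_distrib_left mult_ac)
    qed
    also have "\<dots> = (\<Sum>i<p. \<Sum>j<p. \<Sum>x<m. \<Sum>y<m. \<Sum>a<k. \<Sum>a'<k. \<Sum>b<r. \<Sum>b'<r.
        A x a b * cnj (A y a' b') * X i j a a' * cinner (bop_apply (Q b b') (h j y)) (h i x))"
      by (simp only: sum.swap[of _ "{..<p}" "{..<k}"] sum.swap[of _ "{..<m}" "{..<k}"] sum.swap[of _ "{..<m}" "{..<r}"])
    also have "\<dots> = (\<Sum>i<p. \<Sum>x<m. \<Sum>j<p. \<Sum>y<m. \<Sum>a<k. \<Sum>b<r. \<Sum>a'<k. \<Sum>b'<r.
        A x a b * cnj (A y a' b') * X i j a a' * cinner (bop_apply (Q b b') (h j y)) (h i x))"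
      by (simp only: sum.swap[of _ "{..<p}" "{..<m}"] sum.swap[of _ "{..<k}" "{..<r}"])
    also have "\<dots> = (\<Sum>i<p. \<Sum>x<m. \<Sum>j<p. \<Sum>y<m. cinner (bop_apply (?\<psi> (X i j) x y) (h j y)) (h i x))"
      by (intro sum.cong[OF refl]) (simp add: kron_compression_def bop_sum_left scaleC_bop.rep_eq
          cinner_sum_left cinner_scaleC_left)
    finally show "(\<Sum>i<p. \<Sum>x<m. \<Sum>j<p. \<Sum>y<m. cinner (bop_apply (?\<psi> (X i j) x y) (h j y)) (h i x)) \<in> \<real>\<^sub>\<ge>\<^sub>0" .
  qed
qed

text \<open>Applying f to the left legs of A (P \<otimes> Q) A^* replaces P by the scalar matrix of
  the f(p_ij). So the map of an element of \<open>D_max\<close> is exactly evaluation at P followed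
  by \<open>kron_compression\<close>.\<close>

lemma slice_block_conj:
  assumes S: "complex_vector.subspace S" and T: "complex_vector.subspace T" and b: "sa_basis S d s e"
    and f: "f \<in> dual S" and P: "P \<in> mats k k S" and Q: "Q \<in> mats r r T"
  shows "slice S T (block_conj m k r A P Q i j) f = kron_compression m k r A Q (\<lambda>i j. f (P i j)) i j"
proof (cases "i < m \<and> j < m")
  case True
  have PS: "c *\<^sub>C P a a' \<in> S" if "a < k" "a' < k" for a a' c
    by (intro complex_vector.subspace_scale[OF S] mats_in[OF P] that)
  have QT: "Q b b' \<in> T" if "b < r" "b' < r" for b b' by (rule mats_in[OF Q that])
  \<comment> \<open>The scalar coefficients are moved into the left legs, which leaves elementary
    tensors only; the four sums are then peeled off from the inside.\<close>
  have "slice S T (\<Sum>a<k. \<Sum>b<r. \<Sum>a'<k. \<Sum>b'<r. (c a b a' b' *\<^sub>C P a a') \<otimes>\<^sub>t Q b b') f =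
      (\<Sum>a<k. \<Sum>b<r. \<Sum>a'<k. \<Sum>b'<r. f (c a b a' b' *\<^sub>C P a a') *\<^sub>C Q b b')" for c
  proof -
    have 1: "slice S T (\<Sum>b'<r. (c a b a' b' *\<^sub>C P a a') \<otimes>\<^sub>t Q b b') f =
        (\<Sum>b'<r. f (c a b a' b' *\<^sub>C P a a') *\<^sub>C Q b b')" if "a < k" "b < r" "a' < k" for a b a'
      using that by (intro slice_sum_tens[OF S f]) (simp add: PS QT)
    have m1: "(\<Sum>b'<r. (c a b a' b' *\<^sub>C P a a') \<otimes>\<^sub>t Q b b') \<in> tensor_space S T"
      if "a < k" "b < r" "a' < k" for a b a'
      using that by (intro complex_vector.subspace_sum[OF subspace_tensor_space] tens_in_tensor_space PS QT) auto
    have m2: "(\<Sum>a'<k. \<Sum>b'<r. (c a b a' b' *\<^sub>C P a a') \<otimes>\<^sub>t Q b b') \<in> tensor_space S T"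
      if "a < k" "b < r" for a b
      using that by (intro complex_vector.subspace_sum[OF subspace_tensor_space] m1) auto
    have m3: "(\<Sum>b<r. \<Sum>a'<k. \<Sum>b'<r. (c a b a' b' *\<^sub>C P a a') \<otimes>\<^sub>t Q b b') \<in> tensor_space S T"
      if "a < k" for a
      using that by (intro complex_vector.subspace_sum[OF subspace_tensor_space] m2) auto
    have 2: "slice S T (\<Sum>a'<k. \<Sum>b'<r. (c a b a' b' *\<^sub>C P a a') \<otimes>\<^sub>t Q b b') f =
        (\<Sum>a'<k. \<Sum>b'<r. f (c a b a' b' *\<^sub>C P a a') *\<^sub>C Q b b')" if "a < k" "b < r" for a b
      by (subst slice_sum[OF S T b f]) (use that in \<open>simp_all add: 1 m1\<close>)
    have 3: "slice S T (\<Sum>b<r. \<Sum>a'<k. \<Sum>b'<r. (c a b a' b' *\<^sub>C P a a') \<otimes>\<^sub>t Q b b') f =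
        (\<Sum>b<r. \<Sum>a'<k. \<Sum>b'<r. f (c a b a' b' *\<^sub>C P a a') *\<^sub>C Q b b')" if "a < k" for a
      by (subst slice_sum[OF S T b f]) (use that in \<open>simp_all add: 2 m2\<close>)
    show ?thesis
      by (subst slice_sum[OF S T b f]) (simp_all add: 3 m3)
  qed
  moreover have "f (c *\<^sub>C P a a') = c * f (P a a')" if "a < k" "a' < k" for c a a'
    using clinear_onD(2)[OF dualD(1)[OF f] mats_in[OF P that]] by (simp add: scaleC_complex_def)
  ultimately show ?thesis using True
    by (simp add: block_conj_def kron_compression_def tens_scaleC_left[symmetric])
next
  case False
  then show ?thesis using slice_zero[OF S f] by (simp only: block_conj_def kron_compression_def if_False)
qed

lemma mat_norm_scalar_mat_le: "mat_norm m (scalar_mat m (c *\<^sub>C 1)) \<le> cmod c"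
proof (rule mat_norm_least)
  fix h :: "nat \<Rightarrow> 'a" assume h: "L2_set (\<lambda>j. norm (h j)) {..<m} \<le> 1"
  have "(\<Sum>j<m. bop_apply (scalar_mat m (c *\<^sub>C 1) i j) (h j)) = c *\<^sub>C h i" if "i < m" for i
    by (subst sum_single[of _ i]) (use that in \<open>auto simp: bop_simps\<close>)
  then have "L2_set (\<lambda>i. norm (\<Sum>j<m. bop_apply (scalar_mat m (c *\<^sub>C 1) i j) (h j))) {..<m} =
      L2_set (\<lambda>i. cmod c * norm (h i)) {..<m}"
    by (intro L2_set_cong) (simp_all add: norm_scaleC)
  also have "\<dots> = cmod c * L2_set (\<lambda>j. norm (h j)) {..<m}"
    by (rule L2_set_right_distrib[symmetric]) simp
  also have "\<dots> \<le> cmod c * 1" using h by (rule mult_left_mono) simp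
  finally show "L2_set (\<lambda>i. norm (\<Sum>j<m. bop_apply (scalar_mat m (c *\<^sub>C 1) i j) (h j))) {..<m} \<le> cmod c"
    by simp
qed

text \<open>A decomposition of \<epsilon> 1 + U factors the map of \<epsilon> 1 + U exactly, so the
  error against the map of U is the scalar matrix \<epsilon> f(1).\<close>

lemma ex_factorization:
  fixes S :: "'h::complex_hilbert bop set" and T :: "'k::complex_hilbert bop set"
  assumes S: "operator_system S" and T: "operator_system T" and b: "sa_basis S d s e"
    and U: "U \<in> mats m m (tensor_space S T)" and \<epsilon>: "\<epsilon> > 0"
    and D: "(\<lambda>i j. scalar_mat m (of_real \<epsilon> *\<^sub>C (1 \<otimes>\<^sub>t 1)) i j + U i j) \<in> D_max S T m"
  shows "\<exists>n \<phi> \<psi>. completely_positive (dual_sys (op_sys S)) (mat_alg n) \<phi> \<and>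
    completely_positive (mat_alg n) (mat_over m (op_sys T)) \<psi> \<and>
    (\<forall>f\<in>dual S. mat_norm m (\<psi> (\<phi> f) - hat S T U f) \<le> \<epsilon> * cmod (f 1))"
proof -
  have sub: "complex_vector.subspace S" "1 \<in> S" using S by (simp_all add: operator_system_def)
  have subT: "complex_vector.subspace T" "1 \<in> T" using T by (simp_all add: operator_system_def)
  obtain k r A P Q where P: "P \<in> cone (op_sys S) k" and Q: "Q \<in> cone (op_sys T) r"
    and eq: "(\<lambda>i j. scalar_mat m (of_real \<epsilon> *\<^sub>C (1 \<otimes>\<^sub>t 1)) i j + U i j) = block_conj m k r A P Q"
    using D by (rule D_max_block_conjE)
  let ?\<phi> = "\<lambda>f i j. f (P i j)" and ?\<psi> = "kron_compression m k r A Q"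
  have "mat_norm m (?\<psi> (?\<phi> f) - hat S T U f) \<le> \<epsilon> * cmod (f 1)" if f: "f \<in> dual S" for f
  proof -
    have "?\<psi> (?\<phi> f) - hat S T U f = scalar_mat m ((of_real \<epsilon> * f 1) *\<^sub>C 1)"
    proof (intro ext)
      fix i j
      have Uij: "U i j \<in> tensor_space S T"
        by (rule mats_in_subspace[OF subspace_tensor_space U])
      have e11: "of_real \<epsilon> *\<^sub>C (1 \<otimes>\<^sub>t 1) = (of_real \<epsilon> *\<^sub>C 1 :: 'h bop) \<otimes>\<^sub>t (1 :: 'k bop)"
        by (simp only: tens_scaleC_left)
      have eS: "of_real \<epsilon> *\<^sub>C 1 \<in> S" by (rule complex_vector.subspace_scale[OF sub])
      have "?\<psi> (?\<phi> f) i j = slice S T (block_conj m k r A P Q i j) f"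
        by (rule slice_block_conj[OF sub(1) subT(1) b f cone_op_sys_mats[OF P] cone_op_sys_mats[OF Q], symmetric])
      also have "\<dots> = slice S T (scalar_mat m (of_real \<epsilon> *\<^sub>C (1 \<otimes>\<^sub>t 1)) i j + U i j) f"
        by (simp only: eq[symmetric])
      also have "\<dots> = slice S T (scalar_mat m (of_real \<epsilon> *\<^sub>C (1 \<otimes>\<^sub>t 1)) i j) f + slice S T (U i j) f"
        unfolding e11
        by (rule slice_add[OF sub(1) subT(1) b _ Uij f])
          (auto intro!: tens_in_tensor_space eS subT complex_vector.subspace_0[OF subspace_tensor_space])
      also have "slice S T (scalar_mat m (of_real \<epsilon> *\<^sub>C (1 \<otimes>\<^sub>t 1)) i j) f =
          scalar_mat m (f (of_real \<epsilon> *\<^sub>C 1) *\<^sub>C 1) i j"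
        unfolding e11 by (simp add: slice_tens[OF sub(1) f eS subT(2)] slice_zero[OF sub(1) f])
      also have "f (of_real \<epsilon> *\<^sub>C 1) = of_real \<epsilon> * f 1"
        using clinear_onD(2)[OF dualD(1)[OF f] sub(2)] by (simp add: scaleC_complex_def)
      finally show "(?\<psi> (?\<phi> f) - hat S T U f) i j = scalar_mat m ((of_real \<epsilon> * f 1) *\<^sub>C 1) i j"
        by (simp add: hat_def)
    qed
    then have "mat_norm m (?\<psi> (?\<phi> f) - hat S T U f) \<le> cmod (of_real \<epsilon> * f 1)"
      by (simp only: mat_norm_scalar_mat_le)
    then show ?thesis using \<epsilon> by (simp add: norm_mult)
  qed
  then show ?thesis
    using cp_evaluate_positive_matrix[OF sub(1) P] cp_kron_compression[OF subT(1) Q] by blast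
qed

section \<open>Approximate factorization along nets\<close>

lemma cone_max_tensor:
  "U \<in> cone (max_tensor S T) m \<longleftrightarrow> U \<in> mats m m (tensor_space S T) \<and>
    (\<forall>\<epsilon>>0. (\<lambda>i j. scalar_mat m (of_real \<epsilon> *\<^sub>C (1 \<otimes>\<^sub>t 1)) i j + U i j) \<in> D_max S T m)"
  by (simp add: max_tensor_def)

text \<open>The order of the natural numbers is transported along an injection into the given index
  type, so that a sequence can serve as a net there.\<close>

lemma sequence_net:
  fixes g :: "nat \<Rightarrow> 'i"
  assumes g: "inj g"
  defines "r \<equiv> {(g a, g b) |a b. a \<le> b}"
  shows "directed_set (range g) r"
    and "(X \<longlongrightarrow> l) sequentially \<Longrightarrow> ((\<lambda>i. X (inv g i)) \<longlongrightarrow> l) (tails (range g) r)"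
proof -
  have r: "(g a, g b) \<in> r \<longleftrightarrow> a \<le> b" for a b
    using g by (auto simp: r_def inj_def)
  show dir: "directed_set (range g) r"
    unfolding directed_set_def preorder_on_def
  proof (intro conjI ballI)
    show "r \<subseteq> range g \<times> range g" "refl_on (range g) r"
      by (auto simp: r_def refl_on_def)
    show "trans r"
    proof (rule transI)
      fix x y z assume "(x, y) \<in> r" "(y, z) \<in> r"
      then obtain a b c d where "x = g a" "y = g b" "a \<le> b" "y = g c" "z = g d" "c \<le> d"
        by (auto simp: r_def)
      then have "(x, z) = (g a, g d) \<and> a \<le> d" using g by (auto simp: inj_eq)
      then show "(x, z) \<in> r" unfolding r_def by blast
    qed
    fix i j assume "i \<in> range g" "j \<in> range g"
    then obtain a b where "i = g a" "j = g b" by auto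
    then show "\<exists>k\<in>range g. (i, k) \<in> r \<and> (j, k) \<in> r"
      by (intro bexI[of _ "g (max a b)"]) (simp_all add: r)
  qed simp
  assume X: "(X \<longlongrightarrow> l) sequentially"
  show "((\<lambda>i. X (inv g i)) \<longlongrightarrow> l) (tails (range g) r)"
  proof (rule topological_tendstoI)
    fix V assume "open V" "l \<in> V"
    then obtain N where "X n \<in> V" if "n \<ge> N" for n
      using topological_tendstoD[OF X] by (auto simp: eventually_sequentially)
    then show "eventually (\<lambda>i. X (inv g i) \<in> V) (tails (range g) r)"
      unfolding eventually_tails[OF dir]
      by (intro bexI[of _ "g N"]) (auto simp: r inv_f_f[OF g])
  qed
qed

lemma approximable_if_positive:
  fixes S :: "'h::complex_hilbert bop set" and T :: "'k::complex_hilbert bop set"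
  assumes S: "operator_system S" "fin_dim S" and T: "operator_system T"
    and U: "U \<in> cone (max_tensor S T) m" and inf: "infinite (UNIV :: 'i set)"
  shows "\<exists>(I :: 'i set) r n \<phi> \<psi>. directed_set I r \<and>
      (\<forall>l\<in>I. completely_positive (dual_sys (op_sys S)) (mat_alg (n l)) (\<phi> l)) \<and>
      (\<forall>l\<in>I. completely_positive (mat_alg (n l)) (mat_over m (op_sys T)) (\<psi> l)) \<and>
      (\<forall>f\<in>dual S. ((\<lambda>l. mat_norm m (\<psi> l (\<phi> l f) - hat S T U f)) \<longlongrightarrow> 0) (tails I r))"
proof -
  obtain d s e where b: "sa_basis S d s e" using ex_sa_basis[OF S] .
  obtain g :: "nat \<Rightarrow> 'i" where g: "inj g" using infinite_countable_subset[OF inf] by blast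
  \<comment> \<open>Stage N uses \<epsilon> = 1/(N + 1); for fixed f the error is then at most
    |f(1)|/(N + 1).\<close>
  have "\<exists>n \<phi> \<psi>. completely_positive (dual_sys (op_sys S)) (mat_alg n) \<phi> \<and>
    completely_positive (mat_alg n) (mat_over m (op_sys T)) \<psi> \<and>
    (\<forall>f\<in>dual S. mat_norm m (\<psi> (\<phi> f) - hat S T U f) \<le> inverse (real (Suc N)) * cmod (f 1))" for N
    using U by (intro ex_factorization[OF S(1) T b]) (simp_all add: cone_max_tensor)
  then obtain n \<phi> \<psi> where
    cp: "\<And>N. completely_positive (dual_sys (op_sys S)) (mat_alg (n N)) (\<phi> N)"
      "\<And>N. completely_positive (mat_alg (n N)) (mat_over m (op_sys T)) (\<psi> N)"
    and le: "\<And>N f. f \<in> dual S \<Longrightarrow>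
      mat_norm m (\<psi> N (\<phi> N f) - hat S T U f) \<le> inverse (real (Suc N)) * cmod (f 1)"
    by metis
  let ?r = "{(g a, g b) |a b. a \<le> b}"
  have lim: "((\<lambda>N. mat_norm m (\<psi> N (\<phi> N f) - hat S T U f)) \<longlongrightarrow> 0) sequentially" if f: "f \<in> dual S" for f
  proof (rule tendsto_sandwich[OF always_eventually always_eventually tendsto_const])
    show "\<forall>N. 0 \<le> mat_norm m (\<psi> N (\<phi> N f) - hat S T U f)" by (simp add: mat_norm_nonneg)
    show "\<forall>N. mat_norm m (\<psi> N (\<phi> N f) - hat S T U f) \<le> inverse (real (Suc N)) * cmod (f 1)"
      using le[OF f] by blast
    show "(\<lambda>N. inverse (real (Suc N)) * cmod (f 1)) \<longlonglongrightarrow> 0"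
      using tendsto_mult_right[OF LIMSEQ_inverse_real_of_nat, of "cmod (f 1)"] by simp
  qed
  have "((\<lambda>l. mat_norm m (\<psi> (inv g l) (\<phi> (inv g l) f) - hat S T U f)) \<longlongrightarrow> 0) (tails (range g) ?r)"
    if "f \<in> dual S" for f
    by (rule sequence_net(2)[OF g lim[OF that]])
  with cp show ?thesis
    by (intro exI[of _ "range g"] exI[of _ ?r] exI[of _ "\<lambda>l. n (inv g l)"]
        exI[of _ "\<lambda>l. \<phi> (inv g l)"] exI[of _ "\<lambda>l. \<psi> (inv g l)"] conjI ballI sequence_net(1)[OF g])
qed

lemma positive_if_approximable:
  fixes S :: "'h::complex_hilbert bop set" and T :: "'k::complex_hilbert bop set"
    and I :: "'i set"
  assumes S: "operator_system S" "fin_dim S" and T: "operator_system T"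
    and U: "U \<in> mats m m (tensor_space S T)" and dir: "directed_set I r"
    and \<phi>: "\<And>l. l \<in> I \<Longrightarrow> completely_positive (dual_sys (op_sys S)) (mat_alg (n l)) (\<phi> l)"
    and \<psi>: "\<And>l. l \<in> I \<Longrightarrow> completely_positive (mat_alg (n l)) (mat_over m (op_sys T)) (\<psi> l)"
    and lim: "\<And>f. f \<in> dual S \<Longrightarrow>
      ((\<lambda>l. mat_norm m (\<psi> l (\<phi> l f) - hat S T U f)) \<longlongrightarrow> 0) (tails I r)"
  shows "U \<in> cone (max_tensor S T) m"
  unfolding cone_max_tensor
proof (intro conjI allI impI U)
  fix \<epsilon> :: real assume \<epsilon>: "\<epsilon> > 0"
  have sub: "complex_vector.subspace S" using S by (simp add: operator_system_def)
  have subT: "complex_vector.subspace T" using T by (simp add: operator_system_def)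
  obtain d s e where b: "sa_basis S d s e" using ex_sa_basis[OF S] .
  have ed: "e a \<in> dual S" if "a < d" for a
    using b that by (simp add: sa_basis_def)
  \<comment> \<open>Convergence is pointwise, but only the d functionals \<open>e a\<close> matter,
    so a single index l is good for all of them.\<close>
  have close: "\<exists>l\<in>I. \<forall>a<d. mat_norm m (\<psi> l (\<phi> l (e a)) - hat S T U (e a)) < \<delta>" if "\<delta> > 0" for \<delta>
  proof -
    have "eventually (\<lambda>l. \<forall>a\<in>{..<d}. mat_norm m (\<psi> l (\<phi> l (e a)) - hat S T U (e a)) < \<delta>) (tails I r)"
      using order_tendstoD(2)[OF lim[OF ed] that] by (intro eventually_ball_finite) auto
    then obtain i where i: "i \<in> I" "\<forall>j\<in>I. (i, j) \<in> r \<longrightarrow>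
        (\<forall>a\<in>{..<d}. mat_norm m (\<psi> j (\<phi> j (e a)) - hat S T U (e a)) < \<delta>)"
      unfolding eventually_tails[OF dir] by blast
    moreover have "(i, i) \<in> r"
      using dir i(1) by (simp add: directed_set_def preorder_on_def refl_on_def)
    ultimately show ?thesis by auto
  qed
  have Uij: "U i j \<in> tensor_space S T" for i j
    by (rule mats_in_subspace[OF subspace_tensor_space U])
  have Uexp: "U i j = (\<Sum>a<d. s a \<otimes>\<^sub>t hat S T U (e a) i j)" for i j
    unfolding hat_def by (rule tensor_eq_sum_slice[OF sub subT b Uij])
  have hatT: "hat S T U (e a) \<in> mats m m T" if "a < d" for a
  proof (rule matsI)
    fix i j assume "\<not> (i < m \<and> j < m)"
    then show "hat S T U (e a) i j = 0"
      using mats_zero[OF U] slice_zero[OF sub ed[OF that]] by (simp add: hat_def)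
  next
    fix i j
    obtain w where "\<And>a. a < d \<Longrightarrow> w a \<in> T"
      "\<And>f. f \<in> dual S \<Longrightarrow> slice S T (U i j) f = (\<Sum>a<d. f (s a) *\<^sub>C w a)"
      using slice_expand[OF sub subT b Uij] by metis
    then show "hat S T U (e a) i j \<in> T"
      using ed[OF that] unfolding hat_def
      by (auto intro!: complex_vector.subspace_sum[OF subT] complex_vector.subspace_scale[OF subT])
  qed
  note fac = factorization_in_D_max[OF S(1) b \<phi> \<psi>]
  \<comment> \<open>The approximants have real forms, and the difference is bounded by an
    arbitrarily small norm; so the imaginary part for U is below every positive number.\<close>
  have hat_real: "opform m (hat S T U (e a)) h \<in> \<real>" if a: "a < d" for a h
  proof -
    \<comment> \<open>The summand 1 makes K a positive divisor even if all entries of h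
      vanish.\<close>
    define K where "K = 1 + (\<Sum>i<m. (norm (h i))\<^sup>2)"
    have K: "K > 0" unfolding K_def by (simp add: add_pos_nonneg sum_nonneg)
    have "\<bar>Im (opform m (hat S T U (e a)) h)\<bar> \<le> 0 + \<eta>" if \<eta>: "\<eta> > 0" for \<eta>
    proof -
      obtain l where l: "l \<in> I" and n: "mat_norm m (\<psi> l (\<phi> l (e a)) - hat S T U (e a)) < \<eta> / K"
        using close[of "\<eta> / K"] \<eta> K a by auto
      have "Im (opform m (\<psi> l (\<phi> l (e a)) - hat S T U (e a)) h) = - Im (opform m (hat S T U (e a)) h)"
        using fac(3)[OF l l a, of h] opform_diff[of m "\<psi> l (\<phi> l (e a))" "hat S T U (e a)" h]
        by (simp add: complex_is_Real_iff fun_diff_def)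
      then have "\<bar>Im (opform m (hat S T U (e a)) h)\<bar> \<le>
          cmod (opform m (\<psi> l (\<phi> l (e a)) - hat S T U (e a)) h)"
        using abs_Im_le_cmod by (metis abs_minus_cancel)
      also have "\<dots> \<le> mat_norm m (\<psi> l (\<phi> l (e a)) - hat S T U (e a)) * (\<Sum>i<m. (norm (h i))\<^sup>2)"
        by (rule cmod_opform_le)
      also have "\<dots> \<le> \<eta> / K * K"
        using n K \<eta> by (intro mult_mono) (auto simp: K_def sum_nonneg)
      finally show ?thesis using K by simp
    qed
    then have "\<bar>Im (opform m (hat S T U (e a)) h)\<bar> \<le> 0" by (rule field_le_epsilon)
    then show ?thesis by (simp add: complex_is_Real_iff)
  qed
  have "\<forall>a<d. s a \<in> S \<and> is_adjoint (s a) (s a)" using b by (simp add: sa_basis_def)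
  from small_perturbation_in_D_max[where m = m, OF S(1) T \<epsilon> this]
  obtain \<delta> where \<delta>: "\<delta> > 0" and pert: "\<forall>w. (\<forall>a<d. w a \<in> mats m m T \<and>
      (\<forall>h. opform m (w a) h \<in> \<real>) \<and> mat_norm m (w a) \<le> \<delta>) \<longrightarrow>
      (\<lambda>i j. scalar_mat m (of_real \<epsilon> *\<^sub>C (1 \<otimes>\<^sub>t 1)) i j + (\<Sum>a<d. s a \<otimes>\<^sub>t w a i j)) \<in> D_max S T m"
    by (elim exE conjE) (rule that)
  obtain l where l: "l \<in> I" and n: "\<And>a. a < d \<Longrightarrow> mat_norm m (\<psi> l (\<phi> l (e a)) - hat S T U (e a)) < \<delta>"
    using close[OF \<delta>] by auto
  \<comment> \<open>By \<open>Uexp\<close>, U minus the approximant is \<Sum>_a s_a \<otimes> w_a,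
    in the form that \<open>pert\<close> handles.\<close>
  define w where "w = (\<lambda>a i j. hat S T U (e a) i j - \<psi> l (\<phi> l (e a)) i j)"
  have "(\<lambda>i j. scalar_mat m (of_real \<epsilon> *\<^sub>C (1 \<otimes>\<^sub>t 1)) i j + (\<Sum>a<d. s a \<otimes>\<^sub>t w a i j)) \<in> D_max S T m"
  proof (rule pert[rule_format], intro conjI allI)
    fix a assume a: "a < d"
    show "w a \<in> mats m m T"
      using mats_in[OF hatT[OF a]] mats_in[OF fac(2)[OF l l a]] mats_zero[OF hatT[OF a]]
        mats_zero[OF fac(2)[OF l l a]] complex_vector.subspace_diff[OF subT]
      by (intro matsI) (auto simp: w_def)
    show "opform m (w a) h \<in> \<real>" for h
      unfolding w_def opform_diff by (intro Reals_diff hat_real[OF a] fac(3)[OF l l a])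
    have "mat_norm m (w a) = mat_norm m (\<psi> l (\<phi> l (e a)) - hat S T U (e a))"
    proof -
      have "norm (\<Sum>j<m. bop_apply (w a i j) (h j)) =
          norm (\<Sum>j<m. bop_apply ((\<psi> l (\<phi> l (e a)) - hat S T U (e a)) i j) (h j))" for i h
        by (simp add: w_def bop_simps sum_subtractf norm_minus_commute)
      then show ?thesis unfolding mat_norm_def by simp
    qed
    then show "mat_norm m (w a) \<le> \<delta>" using n[OF a] by simp
  qed
  then have "(\<lambda>i j. \<Sum>c<d. s c \<otimes>\<^sub>t \<psi> l (\<phi> l (e c)) i j) +
      (\<lambda>i j. scalar_mat m (of_real \<epsilon> *\<^sub>C (1 \<otimes>\<^sub>t 1)) i j + (\<Sum>a<d. s a \<otimes>\<^sub>t w a i j)) \<in> D_max S T m"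
    by (rule D_max_add[OF sub subT fac(1)[OF l l]])
  also have "(\<lambda>i j. \<Sum>c<d. s c \<otimes>\<^sub>t \<psi> l (\<phi> l (e c)) i j) +
      (\<lambda>i j. scalar_mat m (of_real \<epsilon> *\<^sub>C (1 \<otimes>\<^sub>t 1)) i j + (\<Sum>a<d. s a \<otimes>\<^sub>t w a i j)) =
      (\<lambda>i j. scalar_mat m (of_real \<epsilon> *\<^sub>C (1 \<otimes>\<^sub>t 1)) i j + U i j)"
  proof (intro ext)
    fix i j
    have "(\<Sum>c<d. s c \<otimes>\<^sub>t \<psi> l (\<phi> l (e c)) i j) + (\<Sum>a<d. s a \<otimes>\<^sub>t w a i j) = U i j"
      unfolding Uexp[of i j] w_def sum.distrib[symmetric] tens_add_right[symmetric] by simp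
    from this[symmetric] show "((\<lambda>i j. \<Sum>c<d. s c \<otimes>\<^sub>t \<psi> l (\<phi> l (e c)) i j) +
      (\<lambda>i j. scalar_mat m (of_real \<epsilon> *\<^sub>C (1 \<otimes>\<^sub>t 1)) i j + (\<Sum>a<d. s a \<otimes>\<^sub>t w a i j))) i j =
      scalar_mat m (of_real \<epsilon> *\<^sub>C (1 \<otimes>\<^sub>t 1)) i j + U i j"
      by (simp only: plus_fun_apply add.commute add.left_commute)
  qed
  finally show "(\<lambda>i j. scalar_mat m (of_real \<epsilon> *\<^sub>C (1 \<otimes>\<^sub>t 1)) i j + U i j) \<in> D_max S T m" .
qed

theorem theorem17:
  fixes S :: "'h::complex_hilbert bop set" and T :: "'k::complex_hilbert bop set"
    and m :: nat and U :: "('h bop, 'k bop) tensor matrix"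
  assumes "operator_system S" and "fin_dim S"
    and "operator_system T" and "fin_dim T"
    and "U \<in> mats m m (vecs (max_tensor S T))"
    and "infinite (UNIV :: 'i set)"
  shows "U \<in> cone (max_tensor S T) m \<longleftrightarrow>
    (\<exists>(I :: 'i set) r (n :: 'i \<Rightarrow> nat)
        (\<phi> :: 'i \<Rightarrow> ('h bop \<Rightarrow> complex) \<Rightarrow> complex matrix)
        (\<psi> :: 'i \<Rightarrow> complex matrix \<Rightarrow> 'k bop matrix).
      directed_set I r \<and>
      (\<forall>l\<in>I. completely_positive (dual_sys (op_sys S)) (mat_alg (n l)) (\<phi> l)) \<and>
      (\<forall>l\<in>I. completely_positive (mat_alg (n l)) (mat_over m (op_sys T)) (\<psi> l)) \<and>
      (\<forall>f\<in>vecs (dual_sys (op_sys S)).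
        ((\<lambda>l. mat_norm m (\<psi> l (\<phi> l f) - hat S T U f)) \<longlongrightarrow> 0) (tails I r)))"
  (is "_ \<longleftrightarrow> ?R")
proof
  assume "U \<in> cone (max_tensor S T) m"
  then show ?R
    using approximable_if_positive[OF assms(1-3) _ assms(6)] by (simp only: vecs_dual_sys vecs_op_sys)
next
  assume ?R
  then obtain I :: "'i set" and r n \<phi> \<psi> where net: "directed_set I r"
    "\<forall>l\<in>I. completely_positive (dual_sys (op_sys S)) (mat_alg (n l)) (\<phi> l)"
    "\<forall>l\<in>I. completely_positive (mat_alg (n l)) (mat_over m (op_sys T)) (\<psi> l)"
    "\<forall>f\<in>vecs (dual_sys (op_sys S)).
      ((\<lambda>l. mat_norm m (\<psi> l (\<phi> l f) - hat S T U f)) \<longlongrightarrow> 0) (tails I r)"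
    by (elim exE conjE) (rule that)
  show "U \<in> cone (max_tensor S T) m"
    by (rule positive_if_approximable[OF assms(1-3) assms(5)[unfolded vecs_max_tensor] net(1)
          bspec[OF net(2)] bspec[OF net(3)] bspec[OF net(4)[unfolded vecs_dual_sys vecs_op_sys]]])
qed

end
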